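(* Let $G=(V,E,w)$ be an $n$-vertex weighted undirected graph with polynomial aspect ratio, let $h,k\in\mathbb{N}$ with $h,k\ge1$, and let $r\in V$. Then there is a path-tree one-to-many embedding $f$ of $G$ into a tree $T$ with hop-bound $O(k\cdot\log^2n\cdot\log\log n)\cdot h$, with $|f(V)|\le(2n)^{1+\frac1k}$ and $|f(r)|=1$, such that for every subgraph $H$ of $G$ there is a subgraph $H'$ of $T$ with the following properties: for every $u,v\in V(H)$ with $\mathrm{hop}_H(u,v)\le h$, $H'$ contains a pair of copies $u'\in f(u)$ and $v'\in f(v)$ in the same connected component of $H'$; and $w_T(H')\le O(k\cdot\log n\cdot\log\log n)\cdot w(H)$.
   Context: Graphs are undirected with finite positive edge weights (only the output tree $T$ may have edges of weight $\infty$). $\mathrm{hop}_H(u,v)$ is the minimum number of edges of a $u$-$v$ path in $H$; $\mathrm{hop}(P)$ is the number of edges of a path $P$. $w(H)$, $w_T(H')$ denote total edge weight. The aspect ratio of $G$ is $\max_{e}w(e)/\min_{e}w(e)$; "polynomial" means at most $n^c$ for a fixed constant $c$ (constants in $O(\cdot)$ may depend on $c$; (iterated) logarithmic factors inside $O(\cdot)$ are understood to be at least $1$). A one-to-many embedding $f:V\to2^{V(T)}$ sends each vertex to a non-empty set of copies, the sets $f(v)$ being pairwise disjoint; $f(A)=\bigcup_{v\in A}f(v)$. It is dominating if $d_G(u,v)\le d_T(u',v')$ for all $u'\in f(u),v'\in f(v)$. A path-tree one-to-many embedding of $G$ consists of a dominating one-to-many embedding $f$ into a tree $T$ with $f(V)=V(T)$,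 together with, for every edge $e=\{u',v'\}\in E(T)$ with $u'\in f(u),v'\in f(v)$, an associated path $P_e^T$ in $G$ from $u$ to $v$ of weight at most $w_T(e)$. Edges of weight $\infty$ represent disconnection: they carry no associated path, and two vertices of $T$ are called connected in $T$ if the $T$-path between them uses only finite-weight edges. For $u',v'$ connected in $T$ by the simple path $e_1,\dots,e_s$, $P^T_{u'v'}=P^T_{e_1}\circ\cdots\circ P^T_{e_s}$ is the concatenation (not necessarily simple). $f$ has hop-bound $\beta$ if $\mathrm{hop}(P^T_{u'v'})\le\beta$ for all $u',v'\in V(T)$ connected in $T$. *)

theory Defs
  imports Complex_Main "HOL-Library.Extended_Nonnegative_Real"
begin

section \<open>Finite simple undirected graphs\<close>

text \<open>Edge weights are kept outside the graph, as a function on edges, so that a subgraph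
  automatically inherits them. Weights live in \<^typ>\<open>ennreal\<close> because trees may carry edges of
  infinite weight; for ordinary weighted graphs finiteness is imposed separately.\<close>

record 'v ugraph =
  verts :: "'v set"
  edges :: "'v set set"

definition graph :: "'v ugraph \<Rightarrow> bool" where
  "graph G \<longleftrightarrow> finite (verts G) \<and> (\<forall>e\<in>edges G. e \<subseteq> verts G \<and> card e = 2)"

definition subgraph :: "'v ugraph \<Rightarrow> 'v ugraph \<Rightarrow> bool" where
  "subgraph H G \<longleftrightarrow> graph H \<and> verts H \<subseteq> verts G \<and> edges H \<subseteq> edges G"

definition weighted_graph :: "'v ugraph \<Rightarrow> ('v set \<Rightarrow> ennreal) \<Rightarrow> bool" where
  "weighted_graph G w \<longleftrightarrow> graph G \<and> (\<forall>e\<in>edges G. 0 < w e \<and> w e < \<infinity>)"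

definition graph_weight :: "('v set \<Rightarrow> ennreal) \<Rightarrow> 'v ugraph \<Rightarrow> ennreal" where
  "graph_weight w H = (\<Sum>e\<in>edges H. w e)"

text \<open>The value 1 for an edgeless graph is a convention.\<close>

definition aspect_ratio :: "'v ugraph \<Rightarrow> ('v set \<Rightarrow> ennreal) \<Rightarrow> ennreal" where
  "aspect_ratio G w = (if edges G = {} then 1 else Max (w ` edges G) / Min (w ` edges G))"


section \<open>Walks, paths, distances\<close>

text \<open>A walk is given by the list of its vertices; \<open>[v]\<close> is the walk without edges at \<open>v\<close>.\<close>

fun walk_edges :: "'v list \<Rightarrow> 'v set list" where
  "walk_edges (x # y # p) = {x, y} # walk_edges (y # p)"
| "walk_edges _ = []"

definition walk :: "'v ugraph \<Rightarrow> 'v list \<Rightarrow> bool" where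
  "walk G p \<longleftrightarrow> p \<noteq> [] \<and> set p \<subseteq> verts G \<and> set (walk_edges p) \<subseteq> edges G"

definition path :: "'v ugraph \<Rightarrow> 'v \<Rightarrow> 'v list \<Rightarrow> 'v \<Rightarrow> bool" where
  "path G u p v \<longleftrightarrow> walk G p \<and> distinct p \<and> hd p = u \<and> last p = v"

definition hop :: "'v list \<Rightarrow> nat" where
  "hop p = length (walk_edges p)"

definition walk_weight :: "('v set \<Rightarrow> ennreal) \<Rightarrow> 'v list \<Rightarrow> ennreal" where
  "walk_weight w p = (\<Sum>e\<leftarrow>walk_edges p. w e)"

text \<open>Both distances are infinite if there is no path.\<close>

definition hop_dist :: "'v ugraph \<Rightarrow> 'v \<Rightarrow> 'v \<Rightarrow> enat" where
  "hop_dist G u v = Inf {enat (hop p) | p. path G u p v}"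

definition dist_graph :: "'v ugraph \<Rightarrow> ('v set \<Rightarrow> ennreal) \<Rightarrow> 'v \<Rightarrow> 'v \<Rightarrow> ennreal" where
  "dist_graph G w u v = Inf {walk_weight w p | p. path G u p v}"

definition same_component :: "'v ugraph \<Rightarrow> 'v \<Rightarrow> 'v \<Rightarrow> bool" where
  "same_component G u v \<longleftrightarrow> (\<exists>p. path G u p v)"

definition cycle :: "'v ugraph \<Rightarrow> 'v list \<Rightarrow> bool" where
  "cycle G p \<longleftrightarrow> walk G p \<and> distinct p \<and> length p \<ge> 3 \<and> {last p, hd p} \<in> edges G"

definition tree :: "'v ugraph \<Rightarrow> bool" where
  "tree T \<longleftrightarrow> graph T \<and> verts T \<noteq> {} \<and>
     (\<forall>u\<in>verts T. \<forall>v\<in>verts T. same_component T u v) \<and> (\<nexists>p. cycle T p)"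


section \<open>Path-tree one-to-many embeddings\<close>

definition one_to_many :: "'a ugraph \<Rightarrow> 'b ugraph \<Rightarrow> ('a \<Rightarrow> 'b set) \<Rightarrow> bool" where
  "one_to_many G T f \<longleftrightarrow>
     (\<forall>v\<in>verts G. f v \<noteq> {} \<and> f v \<subseteq> verts T) \<and>
     (\<forall>u\<in>verts G. \<forall>v\<in>verts G. u \<noteq> v \<longrightarrow> f u \<inter> f v = {})"

definition dominating ::
  "'a ugraph \<Rightarrow> ('a set \<Rightarrow> ennreal) \<Rightarrow> 'b ugraph \<Rightarrow> ('b set \<Rightarrow> ennreal) \<Rightarrow> ('a \<Rightarrow> 'b set) \<Rightarrow> bool" where
  "dominating G w T wT f \<longleftrightarrow>
     (\<forall>u\<in>verts G. \<forall>v\<in>verts G. \<forall>u'\<in>f u. \<forall>v'\<in>f v.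
        dist_graph G w u v \<le> dist_graph T wT u' v')"

text \<open>An associated path has to be traversed in either direction, so \<open>P u' v'\<close> is the path of the
  edge \<open>{u', v'}\<close> oriented from (the original of) \<open>u'\<close> to \<open>v'\<close>, and the opposite orientation is
  its reversal. The values of \<open>P\<close> on edges of infinite weight and on non-edges are irrelevant.\<close>

definition path_tree_embedding ::
  "'a ugraph \<Rightarrow> ('a set \<Rightarrow> ennreal) \<Rightarrow> 'b ugraph \<Rightarrow> ('b set \<Rightarrow> ennreal) \<Rightarrow> ('a \<Rightarrow> 'b set) \<Rightarrow>
   ('b \<Rightarrow> 'b \<Rightarrow> 'a list) \<Rightarrow> bool" where
  "path_tree_embedding G w T wT f P \<longleftrightarrow>
     tree T \<and> (\<forall>e\<in>edges T. 0 < wT e) \<and>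
     one_to_many G T f \<and> dominating G w T wT f \<and> (\<Union>v\<in>verts G. f v) = verts T \<and>
     (\<forall>u\<in>verts G. \<forall>v\<in>verts G. \<forall>u'\<in>f u. \<forall>v'\<in>f v.
        {u', v'} \<in> edges T \<and> wT {u', v'} < \<infinity> \<longrightarrow>
          path G u (P u' v') v \<and> walk_weight w (P u' v') \<le> wT {u', v'} \<and>
          P v' u' = rev (P u' v'))"

definition original :: "'a ugraph \<Rightarrow> ('a \<Rightarrow> 'b set) \<Rightarrow> 'b \<Rightarrow> 'a" where
  "original G f x = (THE v. v \<in> verts G \<and> x \<in> f v)"

definition walk_join :: "'a list \<Rightarrow> 'a list \<Rightarrow> 'a list" where
  "walk_join p q = p @ tl q"

fun induced_walk ::
  "'a ugraph \<Rightarrow> ('a \<Rightarrow> 'b set) \<Rightarrow> ('b \<Rightarrow> 'b \<Rightarrow> 'a list) \<Rightarrow> 'b list \<Rightarrow> 'a list" where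
  "induced_walk G f P (x # y # q) = walk_join (P x y) (induced_walk G f P (y # q))"
| "induced_walk G f P [x] = [original G f x]"
| "induced_walk G f P [] = []"

text \<open>In a tree, the path \<open>q\<close> between two given vertices is unique, so the quantification over
  \<open>q\<close> only ranges over the pairs of vertices that are connected by edges of finite weight.\<close>

definition has_hop_bound ::
  "'a ugraph \<Rightarrow> 'b ugraph \<Rightarrow> ('b set \<Rightarrow> ennreal) \<Rightarrow> ('a \<Rightarrow> 'b set) \<Rightarrow> ('b \<Rightarrow> 'b \<Rightarrow> 'a list) \<Rightarrow>
   real \<Rightarrow> bool" where
  "has_hop_bound G T wT f P \<beta> \<longleftrightarrow>
     (\<forall>u'\<in>verts T. \<forall>v'\<in>verts T. \<forall>q.
        path T u' q v' \<and> (\<forall>e\<in>set (walk_edges q). wT e < \<infinity>) \<longrightarrow>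
          real (hop (induced_walk G f P q)) \<le> \<beta>)"


text \<open>Logarithmic factors in asymptotic bounds are read as being at least 1.\<close>

definition lg :: "real \<Rightarrow> real" where
  "lg x = max 1 (log 2 x)"

end

theory Submission
  imports Defs "HOL-Library.Multiset"
begin

text \<open>The tree is built top-down by ball growing at geometrically decreasing scales \<open>\<rho>\<close>: from a set of
  vertices, a ball around some vertex is made a new cluster, but only a slightly smaller ball, the
  core, is removed from the set. A radius can be chosen among \<open>O(k log log n)\<close> candidates such that the
  duplicated vertices are paid for by the superadditivity of \<open>x powr (1 + 1/k)\<close>.

  A subgraph \<open>H\<close> is first covered, by region growing, with tours through shallow trees of total
  length \<open>O(w(H))\<close>; as the aspect ratio is polynomial, \<open>O(log n)\<close> doublings suffice, so the trees have
  hop radius \<open>O(h log n)\<close>. A tour is then routed down the hierarchy: whenever it visits a core and leaves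
  the cluster, it is cut at the boundary of the cluster and the pieces are reconnected through the root
  at cost \<open>O(k log log n) * \<rho>\<close>. Core and complement of the cluster have distance at least \<open>\<rho>\<close>, so that
  each cut can be charged to a piece of the tour that moves to the next lower scale. Hence a piece is
  charged at most once per scale, \<open>O(log n)\<close> times in total.\<close>

section \<open>Walks\<close>

text \<open>Distances restricted to walks with few hops violate the triangle inequality, since
  concatenating walks adds their hops. Balls therefore grow in length and hops together, by
  \<open>\<rho>\<close> and \<open>q\<close> per step, with the same \<open>q\<close> at every
  scale. A link of finite weight then stands for a walk of at most \<open>J * q\<close> hops with
  \<open>J = O(k log log n)\<close>, whatever its scale. Of the two logarithms in the hop bound, one
  is the hop radius of the tours, the other the depth of the hierarchy; the weight bound contains
  only the latter.

  No auxiliary nodes are created: the centre of a cluster is also the centre of its first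
  subcluster, whose root becomes the root of the cluster. As a centre lies in its own core, it is
  never duplicated inside its cluster, and with \<open>r\<close> as the topmost centre this leaves
  \<open>r\<close> a single copy.

  Covers come with and without the root because a tour that is not cut at some scale must not pay
  for a connection to the root there. The top scale exceeds the length of every tour, so nothing is
  cut there and the top clusters may be joined by infinite links.\<close>

lemma walk_edges_append:
  "p \<noteq> [] \<Longrightarrow> q \<noteq> [] \<Longrightarrow> walk_edges (p @ q) = walk_edges p @ {last p, hd q} # walk_edges q"
proof (induction p rule: walk_edges.induct)
  case ("2_2" x)
  then show ?case by (cases q) auto
qed auto

lemma walk_edges_split: "walk_edges (p @ x # q) = walk_edges (p @ [x]) @ walk_edges (x # q)"
  by (cases "p = []") (simp_all add: walk_edges_append)

lemma walk_edges_rev: "walk_edges (rev p) = rev (walk_edges p)"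
proof (induction p rule: walk_edges.induct)
  case (1 x y p)
  have "walk_edges (rev (x # y # p)) = walk_edges (rev (y # p) @ [x])" by simp
  also have "\<dots> = walk_edges (rev (y # p)) @ [{y, x}]"
    by (subst walk_edges_append) (auto simp: last_rev)
  finally show ?case using 1 by (simp add: insert_commute)
qed auto

lemma walk_edges_subset: "e \<in> set (walk_edges p) \<Longrightarrow> e \<subseteq> set p"
  by (induction p rule: walk_edges.induct) auto

lemma hop_Cons [simp]: "hop (x # y # p) = Suc (hop (y # p))" "hop [x] = 0" "hop [] = 0"
  by (simp_all add: hop_def)

lemma hop_rev [simp]: "hop (rev p) = hop p"
  by (simp add: hop_def walk_edges_rev)

lemma hop_conv_length: "hop p = length p - 1"
  by (induction p rule: walk_edges.induct) auto

lemma walk_singleton [simp]: "walk G [x] \<longleftrightarrow> x \<in> verts G"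
  by (simp add: walk_def)

lemma walk_nonempty: "walk G p \<Longrightarrow> p \<noteq> []"
  by (simp add: walk_def)

lemma walk_Cons: "walk G (x # y # p) \<longleftrightarrow> x \<in> verts G \<and> {x, y} \<in> edges G \<and> walk G (y # p)"
  by (auto simp: walk_def)

lemma walk_rev [simp]: "walk G (rev p) \<longleftrightarrow> walk G p"
  by (simp add: walk_def walk_edges_rev)

lemma path_rev: "path G u p v \<Longrightarrow> path G v (rev p) u"
  by (auto simp: path_def hd_rev last_rev)

lemma walk_split: "walk G (p @ x # q) \<longleftrightarrow> walk G (p @ [x]) \<and> walk G (x # q)"
  by (auto simp: walk_def walk_edges_split[of p x q])

lemma walk_join_props:
  assumes "p \<noteq> []" "q \<noteq> []" "last p = hd q"
  shows "walk_edges (walk_join p q) = walk_edges p @ walk_edges q"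
    and "hd (walk_join p q) = hd p" and "last (walk_join p q) = last q"
    and "walk G p \<Longrightarrow> walk G q \<Longrightarrow> walk G (walk_join p q)"
    and "hop (walk_join p q) = hop p + hop q" and "walk_join p q \<noteq> []"
proof -
  obtain p' x where p: "p = p' @ [x]" using assms by (cases p rule: rev_cases) auto
  obtain q' where q: "q = x # q'" using assms p by (cases q) auto
  have j: "walk_join p q = p' @ x # q'" by (simp add: walk_join_def p q)
  show e: "walk_edges (walk_join p q) = walk_edges p @ walk_edges q"
    unfolding j using walk_edges_split[of p' x q'] by (simp add: p q del: walk_edges.simps)
  show "hd (walk_join p q) = hd p" "last (walk_join p q) = last q"
    unfolding j by (auto simp: p q hd_append)
  show "walk G p \<Longrightarrow> walk G q \<Longrightarrow> walk G (walk_join p q)"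
    unfolding j by (subst walk_split) (simp add: p q)
  show "hop (walk_join p q) = hop p + hop q" by (simp add: hop_def e)
  show "walk_join p q \<noteq> []" unfolding j by simp
qed

text \<open>Closed subwalks between two occurrences of a vertex are cut out, which only discards
  edges. Stating this for multisets of edges bounds weight and hops of the same path
  simultaneously.\<close>

lemma walk_imp_path:
  assumes "walk G p"
  shows "\<exists>q. path G (hd p) q (last p) \<and> mset (walk_edges q) \<subseteq># mset (walk_edges p)"
  using assms
proof (induction "length p" arbitrary: p rule: less_induct)
  case less
  show ?case
  proof (cases "distinct p")
    case True
    then show ?thesis using less.prems by (auto simp: path_def)
  next
    case False
    then obtain xs ys zs y where p: "p = xs @ [y] @ ys @ [y] @ zs"
      using not_distinct_decomp by blast
    let ?q = "xs @ [y] @ zs"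
    have "walk G (xs @ [y])" "walk G (y # zs)"
      using less.prems walk_split[of G xs y "ys @ y # zs"] walk_split[of G "xs @ y # ys" y zs]
      by (simp_all add: p)
    then have w: "walk G ?q" using walk_split[of G xs y zs] by simp
    have "walk_edges p = walk_edges (xs @ [y]) @ walk_edges (y # ys @ [y]) @ walk_edges (y # zs)"
      using walk_edges_split[of xs y "ys @ y # zs"] walk_edges_split[of "y # ys" y zs]
      by (simp add: p)
    moreover have "walk_edges ?q = walk_edges (xs @ [y]) @ walk_edges (y # zs)"
      using walk_edges_split[of xs y zs] by simp
    ultimately have sub: "mset (walk_edges ?q) \<subseteq># mset (walk_edges p)" by simp
    have "hd ?q = hd p" "last ?q = last p" "length ?q < length p"
      by (auto simp: p hd_append)
    with less.hyps[of ?q] w sub show ?thesis by (metis subset_mset.order_trans)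
  qed
qed

lemma mset_subset_sum_list_le:
  fixes f :: "'b \<Rightarrow> 'c::ordered_comm_monoid_add"
  assumes "mset xs \<subseteq># mset ys" "\<And>x. 0 \<le> f x"
  shows "(\<Sum>x\<leftarrow>xs. f x) \<le> (\<Sum>x\<leftarrow>ys. f x)"
proof -
  obtain B where "mset ys = mset xs + B" using assms mset_subset_eq_exists_conv by metis
  then have "(\<Sum>x\<in>#mset ys. f x) = (\<Sum>x\<in>#mset xs. f x) + (\<Sum>x\<in>#B. f x)" by simp
  moreover have "0 \<le> (\<Sum>x\<in>#B. f x)" using assms(2) by (induction B) auto
  ultimately show ?thesis
    by (simp add: add_increasing2 sum_mset_sum_list flip: mset_map)
qed

lemma same_component_iff_walk:
  "same_component G u v \<longleftrightarrow> (\<exists>p. walk G p \<and> hd p = u \<and> last p = v)"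
  unfolding same_component_def by (metis path_def walk_imp_path)

lemma same_component_refl: "u \<in> verts G \<Longrightarrow> same_component G u u"
  unfolding same_component_iff_walk by (intro exI[of _ "[u]"]) simp

lemma same_component_sym: "same_component G u v \<Longrightarrow> same_component G v u"
  unfolding same_component_def by (meson path_rev)

lemma same_component_trans:
  assumes "same_component G u v" "same_component G v x"
  shows "same_component G u x"
proof -
  obtain p q where "walk G p" "hd p = u" "last p = v" "walk G q" "hd q = v" "last q = x"
    using assms unfolding same_component_iff_walk by auto
  then show ?thesis
    unfolding same_component_iff_walk
    by (intro exI[of _ "walk_join p q"]) (auto simp: walk_join_props walk_nonempty)
qed

lemma same_component_edge:
  "{u, v} \<in> edges G \<Longrightarrow> u \<in> verts G \<Longrightarrow> v \<in> verts G \<Longrightarrow> same_component G u v"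
  unfolding same_component_iff_walk by (intro exI[of _ "[u, v]"]) (simp add: walk_Cons)

lemma walk_mono: "walk H p \<Longrightarrow> verts H \<subseteq> verts G \<Longrightarrow> edges H \<subseteq> edges G \<Longrightarrow> walk G p"
  unfolding walk_def by blast

lemma same_component_mono:
  "same_component H u v \<Longrightarrow> verts H \<subseteq> verts G \<Longrightarrow> edges H \<subseteq> edges G \<Longrightarrow> same_component G u v"
  unfolding same_component_iff_walk using walk_mono[of H _ G] by blast

section \<open>Lengths and hop-limited reachability\<close>

definition len :: "('a set \<Rightarrow> ennreal) \<Rightarrow> 'a list \<Rightarrow> real" where
  "len w p = (\<Sum>e\<leftarrow>walk_edges p. enn2real (w e))"

lemma len_nonneg [simp]: "0 \<le> len w p"
  unfolding len_def by (intro sum_list_nonneg) auto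

lemma len_simps [simp]:
  "len w [] = 0" "len w [x] = 0" "len w (x # y # p) = enn2real (w {x, y}) + len w (y # p)"
  by (simp_all add: len_def)

lemma len_split: "len w (p @ x # q) = len w (p @ [x]) + len w (x # q)"
  unfolding len_def walk_edges_split[of p x q] by simp

lemma len_append:
  "p \<noteq> [] \<Longrightarrow> q \<noteq> [] \<Longrightarrow> len w (p @ q) = len w p + enn2real (w {last p, hd q}) + len w q"
  unfolding len_def by (simp add: walk_edges_append)

lemma len_append_ge: "len w p + len w q \<le> len w (p @ q)"
  by (cases "p = []"; cases "q = []") (simp_all add: len_append)

lemma len_rev [simp]: "len w (rev p) = len w p"
  by (simp add: len_def walk_edges_rev rev_map[symmetric] sum_list_rev)

text \<open>A relation with explicit budgets replaces a hop-limited distance: both bounds concern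
  one and the same walk, and both budgets add up under composition.\<close>

definition reach :: "'a ugraph \<Rightarrow> ('a set \<Rightarrow> ennreal) \<Rightarrow> real \<Rightarrow> nat \<Rightarrow> 'a \<Rightarrow> 'a \<Rightarrow> bool" where
  "reach G w a q u v \<longleftrightarrow>
     (\<exists>p. walk G p \<and> hd p = u \<and> last p = v \<and> len w p \<le> a \<and> hop p \<le> q)"

lemma reach_refl: "u \<in> verts G \<Longrightarrow> 0 \<le> a \<Longrightarrow> reach G w a q u u"
  unfolding reach_def by (intro exI[of _ "[u]"]) simp

lemma reach_sym: "reach G w a q u v \<Longrightarrow> reach G w a q v u"
  unfolding reach_def by (metis hd_rev last_rev walk_rev len_rev hop_rev)

lemma reach_mono: "reach G w a q u v \<Longrightarrow> a \<le> a' \<Longrightarrow> q \<le> q' \<Longrightarrow> reach G w a' q' u v"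
  unfolding reach_def by (elim exE conjE, rule exI, intro conjI) (assumption | linarith)+

lemma reach_trans:
  assumes "reach G w a q u v" "reach G w a' q' v x"
  shows "reach G w (a + a') (q + q') u x"
proof -
  obtain p p' where "walk G p" "hd p = u" "last p = v" "len w p \<le> a" "hop p \<le> q"
    "walk G p'" "hd p' = v" "last p' = x" "len w p' \<le> a'" "hop p' \<le> q'"
    using assms unfolding reach_def by auto
  moreover from this have "len w (walk_join p p') = len w p + len w p'"
    by (simp add: len_def walk_join_props walk_nonempty)
  ultimately show ?thesis
    unfolding reach_def
    by (intro exI[of _ "walk_join p p'"]) (auto simp: walk_join_props walk_nonempty)
qed

text \<open>Unlike a bound on the number of hops inside a subgraph, this property of a tour through a shallow
  tree survives passing to contiguous pieces, so that the tour can be cut recursively.\<close>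

definition short_detours :: "'a ugraph \<Rightarrow> ('a set \<Rightarrow> ennreal) \<Rightarrow> nat \<Rightarrow> 'a list \<Rightarrow> bool" where
  "short_detours G w q p \<longleftrightarrow>
     (\<forall>xs ys zs. p = xs @ ys @ zs \<longrightarrow> ys \<noteq> [] \<longrightarrow> reach G w (len w ys) q (hd ys) (last ys))"

lemma short_detours_infix: "short_detours G w q (xs @ ys @ zs) \<Longrightarrow> short_detours G w q ys"
  unfolding short_detours_def by (metis append.assoc)

lemma short_detours_mono: "short_detours G w q p \<Longrightarrow> q \<le> q' \<Longrightarrow> short_detours G w q' p"
  unfolding short_detours_def
  by (intro allI impI, rule reach_mono[OF _ order_refl]) blast+

section \<open>Link trees and their covers\<close>

text \<open>In \<open>Link s W t\<close> the root of \<open>t\<close> is attached by an edge of weight \<open>W\<close> to the root of \<open>s\<close>,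
  which remains the root.\<close>

datatype 'a link_tree = Leaf 'a | Link "'a link_tree" ennreal "'a link_tree"

fun labels :: "'a link_tree \<Rightarrow> 'a list" where
  "labels (Leaf y) = [y]"
| "labels (Link s W t) = labels s @ labels t"

definition root :: "'a link_tree \<Rightarrow> 'a" where
  "root t = hd (labels t)"

fun depth :: "'a link_tree \<Rightarrow> nat" where
  "depth (Leaf y) = 0"
| "depth (Link s W t) = max (depth s) (Suc (depth t))"

fun realisable :: "'a ugraph \<Rightarrow> ('a set \<Rightarrow> ennreal) \<Rightarrow> nat \<Rightarrow> 'a link_tree \<Rightarrow> bool" where
  "realisable G w q (Leaf y) \<longleftrightarrow> y \<in> verts G"
| "realisable G w q (Link s W t) \<longleftrightarrow> realisable G w q s \<and> realisable G w q t \<and> 0 < W \<and>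
     (W < \<infinity> \<longrightarrow> reach G w (enn2real W) q (root s) (root t))"

text \<open>\<open>rooted_cover t S c\<close> holds if some subtree of \<open>t\<close> of weight at most \<open>c\<close> containing the root
  meets all labels in \<open>S\<close>; for \<open>cover\<close> the subtree need not contain the root.\<close>

fun rooted_cover :: "'a link_tree \<Rightarrow> 'a set \<Rightarrow> real \<Rightarrow> bool" where
  "rooted_cover (Leaf y) S c \<longleftrightarrow> S \<subseteq> {y} \<and> 0 \<le> c"
| "rooted_cover (Link s W t) S c \<longleftrightarrow> rooted_cover s S c \<or>
     (W < \<infinity> \<and> (\<exists>S1 S2 c1 c2. rooted_cover s S1 c1 \<and> rooted_cover t S2 c2 \<and>
        S \<subseteq> S1 \<union> S2 \<and> c1 + enn2real W + c2 \<le> c))"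

fun cover :: "'a link_tree \<Rightarrow> 'a set \<Rightarrow> real \<Rightarrow> bool" where
  "cover (Leaf y) S c \<longleftrightarrow> rooted_cover (Leaf y) S c"
| "cover (Link s W t) S c \<longleftrightarrow> rooted_cover (Link s W t) S c \<or> cover s S c \<or> cover t S c"

lemma labels_nonempty [simp]: "labels t \<noteq> []"
  by (induction t) auto

lemma root_simps [simp]: "root (Leaf y) = y" "root (Link s W t) = root s"
  by (simp_all add: root_def hd_append)

lemma rooted_imp_cover: "rooted_cover t S c \<Longrightarrow> cover t S c"
  by (cases t) auto

lemma rooted_cover_mono: "rooted_cover t S c \<Longrightarrow> S' \<subseteq> S \<Longrightarrow> c \<le> c' \<Longrightarrow> rooted_cover t S' c'"
proof (induction t arbitrary: S c S' c')
  case (Link s W t)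
  show ?case
  proof (cases "rooted_cover s S c")
    case True
    with Link show ?thesis by auto
  next
    case False
    with Link.prems(1) obtain S1 S2 c1 c2 where *: "W < \<infinity>" "rooted_cover s S1 c1"
      "rooted_cover t S2 c2" "S \<subseteq> S1 \<union> S2" "c1 + enn2real W + c2 \<le> c" by auto
    moreover have "S' \<subseteq> S1 \<union> S2" "c1 + enn2real W + c2 \<le> c'" using * Link.prems by auto
    ultimately show ?thesis unfolding rooted_cover.simps by blast
  qed
qed auto

lemma cover_mono: "cover t S c \<Longrightarrow> S' \<subseteq> S \<Longrightarrow> c \<le> c' \<Longrightarrow> cover t S' c'"
proof (induction t arbitrary: S c S' c')
  case (Link s W t)
  then show ?case using rooted_cover_mono[of "Link s W t" S c S' c'] unfolding cover.simps by blast
qed auto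

lemma rooted_cover_empty: "rooted_cover t {} 0"
  by (induction t) auto

text \<open>Two subtrees that contain the root share it, so their union is again connected. This is
  why the pieces of a cut tour are extended to a root before they are merged.\<close>

lemma rooted_cover_Un:
  "rooted_cover t S c \<Longrightarrow> rooted_cover t S' c' \<Longrightarrow> rooted_cover t (S \<union> S') (c + c')"
proof (induction t arbitrary: S c S' c')
  case (Link s W t)
  have sum: "rooted_cover (Link s W t) (S \<union> S') (c + c')"
    if A: "rooted_cover s A a" "rooted_cover t B b" "S \<union> S' \<subseteq> A \<union> B" "W < \<infinity>"
      "a + enn2real W + b \<le> c + c'" for A B a b
    using that unfolding rooted_cover.simps by blast
  have nn: "0 \<le> enn2real W" by simp
  consider "rooted_cover s S c" "rooted_cover s S' c'"
    | S1 S2 c1 c2 where "rooted_cover s S c" "W < \<infinity>" "rooted_cover s S1 c1" "rooted_cover t S2 c2"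
        "S' \<subseteq> S1 \<union> S2" "c1 + enn2real W + c2 \<le> c'"
    | S1 S2 c1 c2 where "rooted_cover s S' c'" "W < \<infinity>" "rooted_cover s S1 c1" "rooted_cover t S2 c2"
        "S \<subseteq> S1 \<union> S2" "c1 + enn2real W + c2 \<le> c"
    | S1 S2 c1 c2 S1' S2' c1' c2' where "W < \<infinity>" "rooted_cover s S1 c1" "rooted_cover t S2 c2"
        "S \<subseteq> S1 \<union> S2" "c1 + enn2real W + c2 \<le> c" "rooted_cover s S1' c1'" "rooted_cover t S2' c2'"
        "S' \<subseteq> S1' \<union> S2'" "c1' + enn2real W + c2' \<le> c'"
    using Link.prems unfolding rooted_cover.simps by blast
  then show ?case
  proof cases
    case 1
    then show ?thesis using Link.IH by simp
  next
    case 2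
    show ?thesis
      by (rule sum[OF Link.IH(1)[OF 2(1) 2(3)] 2(4)]) (use 2 in auto)
  next
    case 3
    show ?thesis
      by (rule sum[OF Link.IH(1)[OF 3(1) 3(3)] 3(4)]) (use 3 in auto)
  next
    case 4
    show ?thesis
      by (rule sum[OF Link.IH(1)[OF 4(2) 4(6)] Link.IH(2)[OF 4(3) 4(7)]]) (use 4 nn in \<open>blast | linarith\<close>)+
  qed
qed auto

section \<open>Stars and families of covers\<close>

definition star :: "ennreal \<Rightarrow> 'a link_tree \<Rightarrow> 'a link_tree list \<Rightarrow> 'a link_tree" where
  "star W t ts = foldl (\<lambda>s t. Link s W t) t ts"

lemma star_Nil [simp]: "star W t [] = t"
  and star_snoc [simp]: "star W t (ts @ [s]) = Link (star W t ts) W s"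
  by (simp_all add: star_def)

lemma labels_star: "labels (star W t ts) = concat (map labels (t # ts))"
  by (induction ts rule: rev_induct) auto

lemma root_star [simp]: "root (star W t ts) = root t"
  by (induction ts rule: rev_induct) auto

text \<open>The links pile up on the left spine, which keeps the root in place, so every attached
  tree sinks by a single link however many trees there are.\<close>

lemma depth_star: "\<forall>s\<in>set (t # ts). depth s \<le> d \<Longrightarrow> depth (star W t ts) \<le> Suc d"
  by (induction ts rule: rev_induct) auto

lemma realisable_star:
  assumes "realisable G w q t" "0 < W" "\<forall>s\<in>set ts. realisable G w q s"
    "\<forall>s\<in>set ts. W < \<infinity> \<longrightarrow> reach G w (enn2real W) q (root t) (root s)"
  shows "realisable G w q (star W t ts)"
  using assms by (induction ts rule: rev_induct) auto

lemma cover_star: "s \<in> set (t # ts) \<Longrightarrow> cover s S c \<Longrightarrow> cover (star W t ts) S c"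
  by (induction ts rule: rev_induct) auto

lemma cover_starD:
  "cover (star W t ts) S c \<Longrightarrow> rooted_cover (star W t ts) S c \<or> (\<exists>s\<in>set (t # ts). cover s S c)"
  by (induction ts rule: rev_induct) auto

text \<open>The link from the hub to the root of \<open>s\<close> is all that has to be paid: the
  hub itself is contained in a rooted cover of the empty set at cost 0.\<close>

lemma rooted_cover_star:
  assumes "W < \<infinity>" "s \<in> set (t # ts)" "rooted_cover s S c"
  shows "rooted_cover (star W t ts) S (c + enn2real W)"
  using assms(2)
proof (induction ts rule: rev_induct)
  case Nil
  then show ?case using assms(3) rooted_cover_mono[of t S c S] by auto
next
  case (snoc s' ts)
  show ?case
  proof (cases "s = s'")
    case True
    have "rooted_cover (Link (star W t ts) W s) S (c + enn2real W)"
      unfolding rooted_cover.simps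
      by (intro disjI2 conjI assms(1) exI[of _ "{}"] exI[of _ S] exI[of _ 0] exI[of _ c])
        (auto simp: rooted_cover_empty assms(3))
    with True show ?thesis by simp
  qed (use snoc in auto)
qed

text \<open>The number \<open>m\<close> counts cuts, so it is one less than the number of connected pieces.\<close>

inductive pieces :: "'a link_tree list \<Rightarrow> 'a set \<Rightarrow> nat \<Rightarrow> real \<Rightarrow> bool" for ts where
  single: "t \<in> set ts \<Longrightarrow> cover t S c \<Longrightarrow> pieces ts S 0 c"
| Un: "pieces ts S m c \<Longrightarrow> pieces ts S' m' c' \<Longrightarrow> pieces ts (S \<union> S') (Suc (m + m')) (c + c')"

lemma pieces_mono: "pieces ts S m c \<Longrightarrow> set ts \<subseteq> set ts' \<Longrightarrow> pieces ts' S m c"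
  by (induction rule: pieces.induct) (auto intro: pieces.intros)

lemma pieces_zero: "pieces ts S 0 c \<Longrightarrow> \<exists>t\<in>set ts. cover t S c"
  by (cases rule: pieces.cases) auto

lemma pieces_rooted:
  assumes "pieces ts S m c"
    and "\<And>t S c. t \<in> set ts \<Longrightarrow> cover t S c \<Longrightarrow> rooted_cover T S (c + b)"
  shows "rooted_cover T S (c + (real m + 1) * b)"
  using assms(1)
proof (induction rule: pieces.induct)
  case (single t S c)
  then show ?case using assms(2) by simp
next
  case (Un S m c S' m' c')
  then have "rooted_cover T (S \<union> S') ((c + (real m + 1) * b) + (c' + (real m' + 1) * b))"
    by (intro rooted_cover_Un)
  then show ?case by (simp add: algebra_simps)
qed

section \<open>Hierarchical clustering\<close>

text \<open>Only walks with at most \<open>q\<close> hops are restricted; a light walk with many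
  hops may still join the two sets. For tours, \<open>short_detours\<close> supplies walks to which
  the restriction applies.\<close>

definition separated ::
  "'a ugraph \<Rightarrow> ('a set \<Rightarrow> ennreal) \<Rightarrow> real \<Rightarrow> nat \<Rightarrow> 'a set \<Rightarrow> 'a set \<Rightarrow> bool" where
  "separated G w \<rho> q A B \<longleftrightarrow> (\<forall>a\<in>A. \<forall>b\<in>B. \<forall>x. reach G w x q a b \<longrightarrow> \<rho> \<le> x)"

text \<open>Around every vertex \<open>v\<close> of \<open>X\<close> a cluster \<open>Y\<close> with a core \<open>C\<close> can be cut off. Only the core
  is removed from \<open>X\<close>, so the elements of \<open>Y - C\<close> are duplicated; the inequality on cardinalities
  pays for these copies.\<close>

definition splittable ::
  "'a ugraph \<Rightarrow> ('a set \<Rightarrow> ennreal) \<Rightarrow> real \<Rightarrow> real \<Rightarrow> nat \<Rightarrow> ('a \<Rightarrow> 'a set) \<Rightarrow> bool" where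
  "splittable G w p \<rho> q R \<longleftrightarrow> (\<forall>X v. X \<subseteq> verts G \<longrightarrow> v \<in> X \<longrightarrow>
     (\<exists>C Y. v \<in> C \<and> C \<subseteq> Y \<and> Y \<subseteq> X \<inter> R v \<and> separated G w \<rho> q C (X - Y) \<and>
       real (card Y) powr p + real (card (X - C)) powr p \<le> real (card X) powr p))"

text \<open>The number \<open>\<eta>\<close> bounds the price of extending a cover to the root, and \<open>\<alpha>\<close> is the stretch of
  the covers.\<close>

definition cluster_tree ::
  "'a ugraph \<Rightarrow> ('a set \<Rightarrow> ennreal) \<Rightarrow> real \<Rightarrow> nat \<Rightarrow> nat \<Rightarrow> nat \<Rightarrow> real \<Rightarrow> real \<Rightarrow>
   'a set \<Rightarrow> 'a \<Rightarrow> 'a link_tree \<Rightarrow> bool" where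
  "cluster_tree G w p q Q d \<eta> \<alpha> Y y t \<longleftrightarrow>
     root t = y \<and> set (labels t) = Y \<and> real (length (labels t)) \<le> real (card Y) powr p \<and>
     count_list (labels t) y = 1 \<and> depth t \<le> d \<and> realisable G w Q t \<and>
     (\<forall>S c. cover t S c \<longrightarrow> rooted_cover t S (c + \<eta>)) \<and>
     (\<forall>\<sigma>. \<sigma> \<noteq> [] \<longrightarrow> set \<sigma> \<subseteq> Y \<longrightarrow> short_detours G w q \<sigma> \<longrightarrow> cover t (set \<sigma>) (\<alpha> * len w \<sigma>))"

lemma pieces_append:
  assumes "pieces ts (set xs) m c" "c \<le> \<alpha> * len w xs" "real m * \<rho> \<le> len w xs"
    and "pieces ts (set ys) m' c'" "c' \<le> \<alpha> * len w ys" "real m' * \<rho> + b \<le> len w ys"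
    and "xs \<noteq> []" "ys \<noteq> []" "0 \<le> \<alpha>" "\<rho> \<le> b + enn2real (w {last xs, hd ys})"
  shows "\<exists>m c. pieces ts (set (xs @ ys)) m c \<and> c \<le> \<alpha> * len w (xs @ ys) \<and>
    real m * \<rho> \<le> len w (xs @ ys)"
proof (intro exI conjI)
  show "pieces ts (set (xs @ ys)) (Suc (m + m')) (c + c')"
    using pieces.Un assms by fastforce
  have "c + c' \<le> \<alpha> * (len w xs + len w ys)" using assms by (simp add: distrib_left)
  also have "\<dots> \<le> \<alpha> * len w (xs @ ys)" using len_append_ge assms by (intro mult_left_mono) auto
  finally show "c + c' \<le> \<alpha> * len w (xs @ ys)" .
  show "real (Suc (m + m')) * \<rho> \<le> len w (xs @ ys)"
    using assms by (simp add: len_append algebra_simps)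
qed

lemma takeWhile_split:
  obtains ys zs where "xs = ys @ zs" "\<forall>x\<in>set ys. P x" "zs = [] \<or> \<not> P (hd zs)"
  by (metis takeWhile_dropWhile_id set_takeWhileD hd_dropWhile)

lemma takeWhile_split_rev:
  obtains ys zs where "xs = ys @ zs" "\<forall>x\<in>set zs. P x" "ys = [] \<or> \<not> P (last ys)"
proof -
  obtain ys zs where "rev xs = ys @ zs" "\<forall>x\<in>set ys. P x" "zs = [] \<or> \<not> P (hd zs)"
    using takeWhile_split by metis
  then have "xs = rev zs @ rev ys" "\<forall>x\<in>set (rev ys). P x" "rev zs = [] \<or> \<not> P (last (rev zs))"
    by (auto simp: last_rev rev_swap)
  then show ?thesis using that by blast
qed

text \<open>A tour in \<open>X\<close> that meets the core \<open>C\<close> and leaves \<open>Y\<close> is cut into maximal stretches within \<open>Y\<close>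
  around the visits to \<open>C\<close> and stretches avoiding \<open>C\<close>. Since \<open>C\<close> and \<open>X - Y\<close> are separated, each cut
  is charged to a part of the tour of length \<open>\<rho>\<close>, either inside \<open>Y\<close> or crossing the cut.\<close>

lemma pieces_split:
  assumes sep: "separated G w \<rho> q C (X - Y)" and "C \<subseteq> Y" "0 \<le> \<alpha>"
    and inner: "\<And>\<sigma>. \<sigma> \<noteq> [] \<Longrightarrow> set \<sigma> \<subseteq> Y \<Longrightarrow> short_detours G w q \<sigma> \<Longrightarrow>
      pieces ts (set \<sigma>) 0 (\<alpha> * len w \<sigma>)"
    and outer: "\<And>\<sigma>. \<sigma> \<noteq> [] \<Longrightarrow> set \<sigma> \<subseteq> X - C \<Longrightarrow> short_detours G w q \<sigma> \<Longrightarrow>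
      \<exists>m c. pieces ts (set \<sigma>) m c \<and> c \<le> \<alpha> * len w \<sigma> \<and> real m * \<rho> \<le> len w \<sigma>"
  shows "\<sigma> \<noteq> [] \<Longrightarrow> set \<sigma> \<subseteq> X \<Longrightarrow> short_detours G w q \<sigma> \<Longrightarrow>
    \<exists>m c. pieces ts (set \<sigma>) m c \<and> c \<le> \<alpha> * len w \<sigma> \<and> real m * \<rho> \<le> len w \<sigma>"
proof (induction "length \<sigma>" arbitrary: \<sigma> rule: less_induct)
  case less
  note \<sigma> = less.prems
  have gap: "\<rho> \<le> len w ys"
    if "\<sigma> = xs @ ys @ zs" "ys \<noteq> []" "hd ys \<in> C \<and> last ys \<in> X - Y \<or> last ys \<in> C \<and> hd ys \<in> X - Y"
    for xs ys zs
  proof -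
    have "reach G w (len w ys) q (hd ys) (last ys)"
      using that \<sigma>(3) unfolding short_detours_def by blast
    then show ?thesis using sep reach_sym that(3) unfolding separated_def by fast
  qed
  obtain a b where ab: "\<sigma> = a @ b" "\<forall>x\<in>set a. x \<notin> C" "b = [] \<or> hd b \<in> C"
    using takeWhile_split[of \<sigma> "\<lambda>x. x \<notin> C"] by metis
  show ?case
  proof (cases "b = []")
    case True
    then show ?thesis using ab \<sigma> by (intro outer) auto
  next
    case False
    obtain a1 a2 where a: "a = a1 @ a2" "\<forall>x\<in>set a2. x \<in> Y" "a1 = [] \<or> last a1 \<notin> Y"
      using takeWhile_split_rev[of a "\<lambda>x. x \<in> Y"] by metis
    obtain b1 b2 where b: "b = b1 @ b2" "\<forall>x\<in>set b1. x \<in> Y" "b2 = [] \<or> hd b2 \<notin> Y"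
      using takeWhile_split[of b "\<lambda>x. x \<in> Y"] by metis
    have b1: "b1 \<noteq> []" "hd b1 \<in> C" using False ab b \<open>C \<subseteq> Y\<close> by (cases b1; auto)+
    define y where "y = a2 @ b1"
    have \<sigma>_eq: "\<sigma> = a1 @ y @ b2" by (simp add: ab a b y_def)
    have y: "y \<noteq> []" "set y \<subseteq> Y" using a b b1 by (auto simp: y_def)
    have "short_detours G w q y" using \<sigma>(3) short_detours_infix \<sigma>_eq by metis
    then have py: "pieces ts (set y) 0 (\<alpha> * len w y)" using y by (intro inner) auto
    obtain x b1' where b1': "b1 = x # b1'" using b1 by (cases b1) auto
    \<comment> \<open>The first visit \<open>x\<close> to the core divides \<open>y\<close> into two
      disjoint funds: the part before \<open>x\<close> serves the cut in front of \<open>y\<close>,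
      the part after it the cut behind \<open>y\<close>.\<close>
    have leny: "len w y = len w (a2 @ [x]) + len w b1"
      using len_split[of w a2 x b1'] by (simp add: y_def b1')
    have left: "\<rho> \<le> enn2real (w {last a1, hd y}) + len w (a2 @ [x])" if "a1 \<noteq> []"
    proof -
      have a1X: "last a1 \<in> X" using \<sigma>(2) last_in_set[OF that] by (auto simp: \<sigma>_eq)
      have "\<rho> \<le> len w (last a1 # a2 @ [x])"
        by (rule gap[of "butlast a1" _ "b1' @ b2"])
          (use that a b1 a1X in \<open>auto simp: \<sigma>_eq y_def b1'\<close>)
      also have "\<dots> = enn2real (w {last a1, hd y}) + len w (a2 @ [x])"
        by (cases a2) (auto simp: y_def b1')
      finally show ?thesis .
    qed
    have right: "\<rho> \<le> len w b1 + enn2real (w {last y, hd b2})" if "b2 \<noteq> []"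
    proof -
      have "\<rho> \<le> len w (b1 @ [hd b2])"
        by (rule gap[of "a1 @ a2" _ "tl b2"])
          (use that b b1 \<sigma> in \<open>auto simp: \<sigma>_eq y_def\<close>)
      also have "\<dots> = len w b1 + enn2real (w {last y, hd b2})"
        using b1(1) that by (simp add: len_append y_def)
      finally show ?thesis .
    qed
    \<comment> \<open>The length of \<open>a2 @ [x]\<close> is withheld from the cuts in
      \<open>y @ b2\<close>, so that it is still available for the cut between \<open>a1\<close> and
      \<open>y\<close>.\<close>
    have "\<exists>m c. pieces ts (set (y @ b2)) m c \<and> c \<le> \<alpha> * len w (y @ b2) \<and>
      real m * \<rho> + len w (a2 @ [x]) \<le> len w (y @ b2)"
    proof (cases "b2 = []")
      case True
      then show ?thesis using py leny by fastforce
    next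
      case b2: False
      have "length b2 < length \<sigma>" using y(1) by (simp add: \<sigma>_eq)
      moreover have "short_detours G w q b2"
        using \<sigma>(3) short_detours_infix[of G w q "a1 @ y" b2 "[]"] by (simp add: \<sigma>_eq)
      moreover have "set b2 \<subseteq> X" using \<sigma> by (simp add: \<sigma>_eq)
      ultimately obtain m c where m: "pieces ts (set b2) m c" "c \<le> \<alpha> * len w b2"
        "real m * \<rho> \<le> len w b2" using less.hyps b2 by blast
      show ?thesis
      proof (intro exI conjI)
        show "pieces ts (set (y @ b2)) (Suc (0 + m)) (\<alpha> * len w y + c)"
          using pieces.Un[OF py m(1)] by simp
        have "\<alpha> * len w y + c \<le> \<alpha> * (len w y + len w b2)" using m by (simp add: distrib_left)
        also have "\<dots> \<le> \<alpha> * len w (y @ b2)"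
          using len_append_ge \<open>0 \<le> \<alpha>\<close> by (intro mult_left_mono) auto
        finally show "\<alpha> * len w y + c \<le> \<alpha> * len w (y @ b2)" .
        show "real (Suc (0 + m)) * \<rho> + len w (a2 @ [x]) \<le> len w (y @ b2)"
          using m(3) right[OF b2] leny y(1) b2 by (simp add: len_append algebra_simps)
      qed
    qed
    then obtain m c where m: "pieces ts (set (y @ b2)) m c" "c \<le> \<alpha> * len w (y @ b2)"
      "real m * \<rho> + len w (a2 @ [x]) \<le> len w (y @ b2)" by blast
    show ?thesis
    proof (cases "a1 = []")
      case True
      have "real m * \<rho> \<le> len w (y @ b2)" using m(3) len_nonneg[of w "a2 @ [x]"] by linarith
      then show ?thesis using m True by (auto simp: \<sigma>_eq)
    next
      case a1: False
      have "set a1 \<subseteq> X - C" using \<sigma> ab a by (auto simp: \<sigma>_eq)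
      moreover have "short_detours G w q a1"
        using \<sigma>(3) short_detours_infix[of G w q "[]" a1 "y @ b2"] by (simp add: \<sigma>_eq)
      ultimately obtain m' c' where m': "pieces ts (set a1) m' c'" "c' \<le> \<alpha> * len w a1"
        "real m' * \<rho> \<le> len w a1" using outer a1 by blast
      have "hd (y @ b2) = hd y" using y(1) by simp
      then show ?thesis
        using pieces_append[OF m' m a1] left[OF a1] y(1) \<open>0 \<le> \<alpha>\<close>
        by (simp add: \<sigma>_eq)
    qed
  qed
qed

text \<open>In contrast to \<open>cluster_tree\<close>, a tour may fall apart here, but every cut
  uses up \<open>\<rho>\<close> of its length. In particular, a tour shorter than
  \<open>\<rho>\<close> remains in one piece.\<close>

definition cluster_forest ::
  "'a ugraph \<Rightarrow> ('a set \<Rightarrow> ennreal) \<Rightarrow> real \<Rightarrow> real \<Rightarrow> nat \<Rightarrow> nat \<Rightarrow> nat \<Rightarrow> real \<Rightarrow> real \<Rightarrow>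
   'a set \<Rightarrow> 'a link_tree list \<Rightarrow> bool" where
  "cluster_forest G w p \<rho> q Q d \<eta> \<alpha> X ts \<longleftrightarrow>
     (\<Union>t\<in>set ts. set (labels t)) = X \<and>
     real (length (concat (map labels ts))) \<le> real (card X) powr p \<and>
     (\<forall>t\<in>set ts. depth t \<le> d \<and> realisable G w Q t \<and>
       (\<forall>S c. cover t S c \<longrightarrow> rooted_cover t S (c + \<eta>))) \<and>
     (\<forall>\<sigma>. \<sigma> \<noteq> [] \<longrightarrow> set \<sigma> \<subseteq> X \<longrightarrow> short_detours G w q \<sigma> \<longrightarrow>
       (\<exists>m c. pieces ts (set \<sigma>) m c \<and> c \<le> \<alpha> * len w \<sigma> \<and> real m * \<rho> \<le> len w \<sigma>))"

lemma cluster_forestD: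
  assumes "cluster_forest G w p \<rho> q Q d \<eta> \<alpha> X ts"
  shows "(\<Union>t\<in>set ts. set (labels t)) = X"
    and "real (length (concat (map labels ts))) \<le> real (card X) powr p"
    and "t \<in> set ts \<Longrightarrow> depth t \<le> d" "t \<in> set ts \<Longrightarrow> realisable G w Q t"
    and "t \<in> set ts \<Longrightarrow> cover t S c \<Longrightarrow> rooted_cover t S (c + \<eta>)"
    and "\<sigma> \<noteq> [] \<Longrightarrow> set \<sigma> \<subseteq> X \<Longrightarrow> short_detours G w q \<sigma> \<Longrightarrow>
      \<exists>m c. pieces ts (set \<sigma>) m c \<and> c \<le> \<alpha> * len w \<sigma> \<and> real m * \<rho> \<le> len w \<sigma>"
  using assms unfolding cluster_forest_def by auto

text \<open>Clusters are peeled off one by one, and the inequality of \<open>splittable\<close>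
  telescopes to the bound on the number of copies. The centre of the first cluster is prescribed so
  that the caller can make it the hub of a star.\<close>

lemma cluster_forest:
  assumes fin: "finite (verts G)" and split: "splittable G w p \<rho> q R" and "0 \<le> \<alpha>"
    and trees: "\<And>Y y. y \<in> Y \<Longrightarrow> Y \<subseteq> verts G \<inter> R y \<Longrightarrow> \<exists>t. cluster_tree G w p q Q d \<eta> \<alpha> Y y t"
  shows "X \<subseteq> verts G \<Longrightarrow> v \<in> X \<Longrightarrow> \<exists>t ts. root t = v \<and>
    count_list (concat (map labels (t # ts))) v = 1 \<and>
    cluster_forest G w p \<rho> q Q d \<eta> \<alpha> X (t # ts)"
proof (induction "card X" arbitrary: X v rule: less_induct)
  case less
  obtain C Y where CY: "v \<in> C" "C \<subseteq> Y" "Y \<subseteq> X \<inter> R v" "separated G w \<rho> q C (X - Y)"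
    and card: "real (card Y) powr p + real (card (X - C)) powr p \<le> real (card X) powr p"
    using split[unfolded splittable_def, rule_format, OF less.prems] by blast
  obtain t where "cluster_tree G w p q Q d \<eta> \<alpha> Y v t"
    using trees[of v Y] CY less.prems by blast
  then have t: "root t = v" "set (labels t) = Y" "real (length (labels t)) \<le> real (card Y) powr p"
    "count_list (labels t) v = 1" "depth t \<le> d" "realisable G w Q t"
    "\<And>S c. cover t S c \<Longrightarrow> rooted_cover t S (c + \<eta>)"
    "\<And>\<sigma>. \<sigma> \<noteq> [] \<Longrightarrow> set \<sigma> \<subseteq> Y \<Longrightarrow> short_detours G w q \<sigma> \<Longrightarrow> cover t (set \<sigma>) (\<alpha> * len w \<sigma>)"
    unfolding cluster_tree_def by auto
  obtain ts where ts: "cluster_forest G w p \<rho> q Q d \<eta> \<alpha> (X - C) ts"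
  proof (cases "X - C = {}")
    case True
    have "cluster_forest G w p \<rho> q Q d \<eta> \<alpha> (X - C) []"
      unfolding cluster_forest_def True by auto
    then show ?thesis by (rule that)
  next
    case False
    then obtain u where u: "u \<in> X - C" by blast
    have "finite X" using fin less.prems(1) finite_subset by blast
    then have "card (X - C) < card X" using CY less.prems by (intro psubset_card_mono) auto
    moreover have "X - C \<subseteq> verts G" using less.prems(1) by blast
    ultimately show ?thesis using less.hyps u that by blast
  qed
  note ts = cluster_forestD[OF ts]
  have "cluster_forest G w p \<rho> q Q d \<eta> \<alpha> X (t # ts)"
    unfolding cluster_forest_def
  proof (intro conjI ballI allI impI)
    show "(\<Union>s\<in>set (t # ts). set (labels s)) = X" using ts(1) t(2) CY by auto
    show "real (length (concat (map labels (t # ts)))) \<le> real (card X) powr p"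
      using t(3) ts(2) card by simp
    fix s assume "s \<in> set (t # ts)"
    then show "depth s \<le> d" "realisable G w Q s"
      "\<And>S c. cover s S c \<Longrightarrow> rooted_cover s S (c + \<eta>)"
      using t ts by auto
  next
    fix \<sigma> :: "'a list" assume \<sigma>: "\<sigma> \<noteq> []" "set \<sigma> \<subseteq> X" "short_detours G w q \<sigma>"
    show "\<exists>m c. pieces (t # ts) (set \<sigma>) m c \<and> c \<le> \<alpha> * len w \<sigma> \<and> real m * \<rho> \<le> len w \<sigma>"
    proof (rule pieces_split[OF CY(4) CY(2) \<open>0 \<le> \<alpha>\<close> _ _ \<sigma>])
      fix \<sigma> :: "'a list" assume "\<sigma> \<noteq> []" "set \<sigma> \<subseteq> Y" "short_detours G w q \<sigma>"
      then show "pieces (t # ts) (set \<sigma>) 0 (\<alpha> * len w \<sigma>)" using t(8) by (intro pieces.single) auto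
    next
      fix \<sigma> :: "'a list" assume "\<sigma> \<noteq> []" "set \<sigma> \<subseteq> X - C" "short_detours G w q \<sigma>"
      then obtain m c where "pieces ts (set \<sigma>) m c" "c \<le> \<alpha> * len w \<sigma>" "real m * \<rho> \<le> len w \<sigma>"
        using ts(6) by blast
      then show "\<exists>m c. pieces (t # ts) (set \<sigma>) m c \<and> c \<le> \<alpha> * len w \<sigma> \<and> real m * \<rho> \<le> len w \<sigma>"
        using pieces_mono[of ts "set \<sigma>" m c "t # ts"] by auto
    qed
  qed
  \<comment> \<open>The centre lies in the core, and all later clusters are formed inside
    \<open>X - C\<close>.\<close>
  moreover have "v \<notin> set (concat (map labels ts))" using ts(1) CY by auto
  then have "count_list (concat (map labels (t # ts))) v = 1"
    using t(4) count_notin[of v "concat (map labels ts)"] by simp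
  ultimately show ?case using t(1) by blast
qed

text \<open>One further scale is put on top by a star around \<open>y\<close>. A tour cut
  \<open>m > 0\<close> times has \<open>m + 1\<close> pieces, each of which reaches the hub at cost
  \<open>\<eta> + W\<close>, while an uncut tour keeps its cover unchanged.\<close>

lemma cluster_tree_Suc:
  assumes fin: "finite (verts G)" and split: "splittable G w p \<rho> q R" and "0 \<le> \<alpha>" "0 < \<rho>" "0 \<le> \<eta>"
    and trees: "\<And>Y y. y \<in> Y \<Longrightarrow> Y \<subseteq> verts G \<inter> R y \<Longrightarrow> \<exists>t. cluster_tree G w p q Q d \<eta> \<alpha> Y y t"
    and "0 < W" and reach: "\<And>u. u \<in> Y \<Longrightarrow> reach G w W Q y u"
    and "y \<in> Y" "Y \<subseteq> verts G"
  shows "\<exists>t. cluster_tree G w p q Q (Suc d) (\<eta> + W) (\<alpha> + 2 * (\<eta> + W) / \<rho>) Y y t"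
proof -
  \<comment> \<open>The centre of \<open>Y\<close> is chosen again as the centre of its first
    subcluster, so the star needs no new node.\<close>
  obtain t ts where root: "root t = y" and count: "count_list (concat (map labels (t # ts))) y = 1"
    and forest: "cluster_forest G w p \<rho> q Q d \<eta> \<alpha> Y (t # ts)"
    using cluster_forest[OF fin split \<open>0 \<le> \<alpha>\<close> _ \<open>Y \<subseteq> verts G\<close> \<open>y \<in> Y\<close>, of Q d \<eta>] trees
    by fast
  note forest = cluster_forestD[OF forest]
  let ?t = "star (ennreal W) t ts"
  have rooted: "rooted_cover ?t S (c + (\<eta> + W))" if "s \<in> set (t # ts)" "cover s S c" for s S c
    using rooted_cover_star[of "ennreal W" s t ts S "c + \<eta>"] forest(5)[OF that] that \<open>0 < W\<close>
    by (simp add: add.assoc)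
  have height: "rooted_cover ?t S (c + (\<eta> + W))" if "cover ?t S c" for S c
    using cover_starD[OF that]
  proof
    assume "rooted_cover ?t S c"
    then show ?thesis by (rule rooted_cover_mono) (use \<open>0 \<le> \<eta>\<close> \<open>0 < W\<close> in auto)
  next
    assume "\<exists>s\<in>set (t # ts). cover s S c"
    then show ?thesis by (elim bexE) (rule rooted)
  qed
  have "cover ?t (set \<sigma>) ((\<alpha> + 2 * (\<eta> + W) / \<rho>) * len w \<sigma>)"
    if \<sigma>: "\<sigma> \<noteq> []" "set \<sigma> \<subseteq> Y" "short_detours G w q \<sigma>" for \<sigma>
  proof -
    obtain m c where m: "pieces (t # ts) (set \<sigma>) m c" "c \<le> \<alpha> * len w \<sigma>" "real m * \<rho> \<le> len w \<sigma>"
      using forest(6)[OF \<sigma>] by blast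
    show ?thesis
    proof (cases "m = 0")
      case True
      then obtain s where "s \<in> set (t # ts)" "cover s (set \<sigma>) c" using m(1) pieces_zero by blast
      then have "cover ?t (set \<sigma>) c" by (rule cover_star)
      moreover have "0 \<le> 2 * (\<eta> + W) / \<rho> * len w \<sigma>"
        using \<open>0 \<le> \<eta>\<close> \<open>0 < W\<close> \<open>0 < \<rho>\<close> by (intro mult_nonneg_nonneg) auto
      then have "c \<le> (\<alpha> + 2 * (\<eta> + W) / \<rho>) * len w \<sigma>" using m(2) by (simp add: distrib_right)
      ultimately show ?thesis using cover_mono by blast
    next
      case False
      have "rooted_cover ?t (set \<sigma>) (c + (real m + 1) * (\<eta> + W))"
        using m(1) rooted by (rule pieces_rooted)
      moreover have "c + (real m + 1) * (\<eta> + W) \<le> (\<alpha> + 2 * (\<eta> + W) / \<rho>) * len w \<sigma>"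
      proof -
        have "real m \<le> len w \<sigma> / \<rho>" using m(3) \<open>0 < \<rho>\<close> by (simp add: field_simps)
        \<comment> \<open>There are more pieces than cuts; \<open>1 \<le> m\<close> absorbs the
          surplus piece, which is the origin of the factor 2 in the stretch.\<close>
        then have "real m + 1 \<le> 2 * (len w \<sigma> / \<rho>)" using False by simp
        then have "(real m + 1) * (\<eta> + W) \<le> 2 * (len w \<sigma> / \<rho>) * (\<eta> + W)"
          using \<open>0 \<le> \<eta>\<close> \<open>0 < W\<close> by (intro mult_right_mono) auto
        also have "\<dots> = 2 * (\<eta> + W) / \<rho> * len w \<sigma>" by simp
        finally show ?thesis using m(2) by (simp add: distrib_right)
      qed
      ultimately show ?thesis using rooted_cover_mono rooted_imp_cover by blast
    qed
  qed
  moreover have "set (labels ?t) = Y" using forest(1) by (simp add: labels_star)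
  moreover have "realisable G w Q ?t"
  proof (rule realisable_star)
    show "\<forall>s\<in>set ts. ennreal W < \<infinity> \<longrightarrow> reach G w (enn2real (ennreal W)) Q (root t) (root s)"
    proof (intro ballI impI)
      fix s assume "s \<in> set ts"
      then have "root s \<in> Y" using forest(1) hd_in_set[of "labels s"] by (auto simp: root_def)
      then show "reach G w (enn2real (ennreal W)) Q (root t) (root s)"
        using reach root \<open>0 < W\<close> by simp
    qed
  qed (use forest(4) \<open>0 < W\<close> in auto)
  moreover have "depth ?t \<le> Suc d" using forest(3) by (intro depth_star) auto
  ultimately show ?thesis
    using height root forest(2) count unfolding cluster_tree_def
    by (intro exI[of _ ?t]) (simp add: labels_star)
qed

section \<open>Ball growing\<close>

lemma powr_Suc_le:
  fixes x y a :: real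
  assumes "0 \<le> x" "x \<le> y" "0 \<le> a"
  shows "x powr (1 + a) \<le> x * y powr a"
proof -
  have "x powr (1 + a) = x * x powr a" using assms by (simp add: powr_add)
  also have "\<dots> \<le> x * y powr a" using assms by (intro mult_left_mono powr_mono2) auto
  finally show ?thesis .
qed

lemma powr_superadditive:
  fixes x y a :: real
  assumes "0 \<le> x" "0 \<le> y" "0 \<le> a"
  shows "x powr (1 + a) + y powr (1 + a) \<le> (x + y) powr (1 + a)"
proof -
  have "x powr (1 + a) + y powr (1 + a) \<le> x * (x + y) powr a + y * (x + y) powr a"
    using assms by (intro add_mono powr_Suc_le) auto
  also have "\<dots> = (x + y) powr (1 + a)" using assms by (simp add: powr_add distrib_right)
  finally show ?thesis .
qed

lemma geometric_decay:
  fixes x :: "nat \<Rightarrow> real"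
  assumes "0 < p" "\<And>j. j \<le> M \<Longrightarrow> p * x (Suc j) < x j"
  shows "p ^ Suc M * x (Suc M) < x 0"
  using assms(2)
proof (induction M)
  case (Suc M)
  have "p ^ Suc (Suc M) * x (Suc (Suc M)) = p ^ Suc M * (p * x (Suc (Suc M)))" by simp
  also have "\<dots> < p ^ Suc M * x (Suc M)" using assms(1) Suc.prems by (intro mult_strict_left_mono) auto
  also have "\<dots> < x 0" using Suc by simp
  finally show ?case .
qed simp

text \<open>By Bernoulli's inequality, \<open>k\<close> factors already give 2. This is where the
  number of growth steps acquires its factor \<open>k\<close>.\<close>

lemma power_Suc_inverse_ge:
  assumes "1 \<le> k"
  shows "(2::real) ^ m \<le> (1 + 1 / real k) ^ (k * m)"
proof -
  have "(2::real) \<le> (1 + 1 / real k) ^ k"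
    using Bernoulli_inequality[of "1 / real k" k] assms by (simp add: order_trans[of "- 1" 0])
  then show ?thesis unfolding power_mult by (intro power_mono) auto
qed

text \<open>As long as the ball is small, \<open>N / b j\<close> decreases doubly exponentially; as soon as it contains
  half of the points, \<open>N / (N - b j)\<close> increases doubly exponentially. Both phases are over after
  \<open>O(k log log N)\<close> steps.\<close>

lemma growth_step_exists:
  fixes b :: "nat \<Rightarrow> nat"
  assumes k: "1 \<le> k" and m: "log 2 (real N) \<le> 2 ^ m"
    and b: "\<And>j. 1 \<le> b j" "\<And>j. b j \<le> N"
  defines "p \<equiv> 1 + 1 / real k"
  shows "\<exists>j<2 * (k * m + 1). real (b (Suc j)) powr p + real (N - b j) powr p \<le> real N powr p"
proof (rule ccontr)
  define M where "M = k * m + 1"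
  assume "\<not> ?thesis"
  then have fail: "real N powr p < real (b (Suc j)) powr p + real (N - b j) powr p"
    if "j < 2 * M" for j using that by (auto simp: M_def not_le)
  have p: "0 < p" "1 \<le> p" using k by (auto simp: p_def add_pos_nonneg)
  have N: "1 \<le> N" using b[of 0] by linarith
  let ?s = "real N powr (1 / real k)"
  have s: "0 < ?s" "ln ?s = ln (real N) / real k" using N by (auto simp: ln_powr)
  have Np: "real N powr p = real N * ?s" using N by (simp add: p_def powr_add)
  have lnN: "ln (real N) \<le> 2 ^ m * ln 2" using m by (simp add: log_def field_simps)
  have le: "real x powr p \<le> real x * ?s" if "x \<le> N" for x
    unfolding p_def using that by (intro powr_Suc_le) auto
  have diff: "real (N - b j) = real N - real (b j)" for j using b by (simp add: of_nat_diff)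
  \<comment> \<open>The logarithm of \<open>N / b j\<close>; dividing it by \<open>p\<close> in each
    step makes \<open>N / b j\<close> fall doubly exponentially.\<close>
  define x where "x j = ln (real N) - ln (real (b j))" for j
  have x_step: "p * x (Suc j) < x j" if "j < 2 * M" for j
  proof -
    \<comment> \<open>Only the power belonging to the complement is linearised, by
      \<open>x powr p \<le> x * N powr (1 / k)\<close>; its term then cancels against
      \<open>real N * ?s\<close> except for \<open>real (b j) * ?s\<close>.\<close>
    have "real N * ?s < real (b (Suc j)) powr p + (real N - real (b j)) * ?s"
      using fail[OF that] le[of "N - b j"] by (simp add: Np diff)
    then have "real (b j) * ?s < real (b (Suc j)) powr p" by (simp add: algebra_simps)
    then have "ln (real (b j) * ?s) < ln (real (b (Suc j)) powr p)"
      using s b[of j] b[of "Suc j"] by (subst ln_less_cancel_iff) auto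
    then have "ln (real (b j)) + ln (real N) / real k < p * ln (real (b (Suc j)))"
      using s b(1)[of j] b(1)[of "Suc j"] by (simp add: ln_mult ln_powr)
    then show ?thesis by (simp add: x_def p_def algebra_simps)
  qed
  have pM: "2 ^ m \<le> p ^ (k * m)" unfolding p_def by (rule power_Suc_inverse_ge[OF k])
  have "p ^ M * x M < x 0"
    using geometric_decay[of p "k * m" x] x_step p by (simp add: M_def)
  also have "x 0 \<le> ln (real N)" using b(1)[of 0] by (simp add: x_def)
  also have "\<dots> \<le> p ^ M * ln 2"
  proof -
    have "2 ^ m \<le> p ^ M" using pM power_increasing[of "k * m" M p] p unfolding M_def by linarith
    then have "2 ^ m * ln 2 \<le> p ^ M * ln 2" by (intro mult_right_mono) auto
    then show ?thesis using lnN by linarith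
  qed
  finally have xM: "x M < ln 2" using p by simp
  have "ln (real N / real (b M)) < ln 2" using xM N b(1)[of M] by (simp add: x_def ln_div)
  then have half: "real N < 2 * real (b M)"
    using N b(1)[of M] by (subst (asm) ln_less_cancel_iff) (auto simp: field_simps)
  define c where "c j = real (N - b j)" for j
  \<comment> \<open>If the ball were everything, the term of the complement would vanish and the
    step would succeed by monotonicity.\<close>
  have c: "1 \<le> c j" if "j < 2 * M" for j
  proof (rule ccontr)
    assume "\<not> ?thesis"
    then have "N - b j = 0" by (simp add: c_def)
    then have "real N powr p < real (b (Suc j)) powr p" using fail[OF that] by simp
    then show False using powr_mono2[of p "real (b (Suc j))" "real N"] p b(2)[of "Suc j"] by auto
  qed
  define y where "y j = ln (c (M + j)) - ln (real N)" for j
  have y_step: "p * y j > y (Suc j)" if "Suc (M + j) < 2 * M" for j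
  proof -
    \<comment> \<open>In the second phase the roles are exchanged: the power of the ball is
      linearised and that of the complement is kept.\<close>
    have "real N * ?s < real (b (Suc (M + j))) * ?s + c (M + j) powr p"
      using fail[of "M + j"] that le[OF b(2)[of "Suc (M + j)"]] by (simp add: Np c_def)
    then have "c (Suc (M + j)) * ?s < c (M + j) powr p"
      by (simp add: algebra_simps c_def diff)
    then have "ln (c (Suc (M + j)) * ?s) < ln (c (M + j) powr p)"
      using s c[of "M + j"] c[of "Suc (M + j)"] that by (subst ln_less_cancel_iff) auto
    then have "ln (c (Suc (M + j))) + ln (real N) / real k < p * ln (c (M + j))"
      using s c[of "M + j"] c[of "Suc (M + j)"] that by (simp add: ln_mult ln_powr)
    then show ?thesis by (simp add: y_def p_def algebra_simps)
  qed
  have "y j \<le> p ^ j * y 0" if "M + j < 2 * M" for j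
    using that
  proof (induction j)
    case (Suc j)
    have "y (Suc j) < p * y j" using y_step Suc.prems by simp
    also have "\<dots> \<le> p * (p ^ j * y 0)" using Suc p by (intro mult_left_mono) auto
    finally show ?case by simp
  qed simp
  then have "y (k * m) \<le> p ^ (k * m) * y 0" by (simp add: M_def)
  moreover have "y 0 < - ln 2"
  proof -
    have "c M < real N / 2" using half by (simp add: c_def diff)
    then have "ln (c M) < ln (real N / 2)"
      using c[of M] N by (subst ln_less_cancel_iff) (auto simp: M_def)
    then show ?thesis using N by (simp add: y_def ln_div)
  qed
  then have "p ^ (k * m) * y 0 < p ^ (k * m) * (- ln 2)"
    using p by (intro mult_strict_left_mono) auto
  moreover have "2 ^ m * ln 2 \<le> p ^ (k * m) * ln 2" using pM by (intro mult_right_mono) auto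
  then have "p ^ (k * m) * (- ln 2) \<le> - ln (real N)" using lnN by linarith
  \<comment> \<open>The index \<open>M + k * m\<close> equals \<open>2 * M - 1\<close>, the last one
    at which failure still forces a vertex outside the ball.\<close>
  moreover have "- ln (real N) \<le> y (k * m)"
    using c[of "M + k * m"] by (simp add: y_def M_def)
  ultimately show False by linarith
qed

section \<open>Splitting at each scale and the complete hierarchy\<close>

definition wball :: "'a ugraph \<Rightarrow> ('a set \<Rightarrow> ennreal) \<Rightarrow> real \<Rightarrow> nat \<Rightarrow> 'a \<Rightarrow> 'a set" where
  "wball G w a q v = {u. reach G w a q v u}"

text \<open>Core and cluster are consecutive balls of the sequence with length
  \<open>j * \<rho>\<close> and \<open>j * q\<close> hops. A walk that leaves the core with at most
  \<open>q\<close> hops and length below \<open>\<rho>\<close> therefore still ends inside the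
  cluster.\<close>

lemma splittable_wball:
  assumes fin: "finite (verts G)" and "1 \<le> k" and m: "log 2 (real (card (verts G))) \<le> 2 ^ m"
    and "0 \<le> \<rho>" and J: "J = 2 * (k * m + 1)"
  shows "splittable G w (1 + 1 / real k) \<rho> q (wball G w (real J * \<rho>) (J * q))"
  unfolding splittable_def
proof (intro allI impI)
  fix X v assume X: "X \<subseteq> verts G" "v \<in> X"
  define B where "B j = X \<inter> wball G w (real j * \<rho>) (j * q) v" for j :: nat
  have finX: "finite X" using X fin finite_subset by blast
  have mono: "B i \<subseteq> B j" if "i \<le> j" for i j
    using that \<open>0 \<le> \<rho>\<close> unfolding B_def wball_def by (auto elim!: reach_mono intro: mult_right_mono)
  have vB: "v \<in> B j" for j
    using X \<open>0 \<le> \<rho>\<close> by (auto simp: B_def wball_def intro!: reach_refl)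
  have BX: "B j \<subseteq> X" for j by (auto simp: B_def)
  have "1 \<le> card (B j)" "card (B j) \<le> card X" for j
    using vB BX finX by (auto simp: Suc_le_eq card_gt_0_iff intro: finite_subset card_mono)
  moreover have "log 2 (real (card X)) \<le> 2 ^ m"
  proof -
    have "0 < card X" "card X \<le> card (verts G)"
      using X fin finX by (auto simp: card_gt_0_iff intro: card_mono)
    then have "log 2 (real (card X)) \<le> log 2 (real (card (verts G)))" by simp
    then show ?thesis using m by linarith
  qed
  ultimately obtain j where j: "j < J" "real (card (B (Suc j))) powr (1 + 1 / real k) +
      real (card X - card (B j)) powr (1 + 1 / real k) \<le> real (card X) powr (1 + 1 / real k)"
    using growth_step_exists[OF \<open>1 \<le> k\<close>, of "card X" m "\<lambda>j. card (B j)"] J by blast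
  have sep: "separated G w \<rho> q (B j) (X - B (Suc j))"
    unfolding separated_def
  proof (intro ballI allI impI, rule ccontr)
    fix a b x assume a: "a \<in> B j" and b: "b \<in> X - B (Suc j)" and ab: "reach G w x q a b"
      and "\<not> \<rho> \<le> x"
    then have "reach G w (real j * \<rho> + x) (j * q + q) v b"
      using reach_trans[OF _ ab] by (auto simp: B_def wball_def)
    then have "reach G w (real (Suc j) * \<rho>) (Suc j * q) v b"
      by (rule reach_mono) (use \<open>\<not> \<rho> \<le> x\<close> in \<open>auto simp: algebra_simps\<close>)
    then show False using b by (auto simp: B_def wball_def)
  qed
  show "\<exists>C Y. v \<in> C \<and> C \<subseteq> Y \<and> Y \<subseteq> X \<inter> wball G w (real J * \<rho>) (J * q) v \<and>
    separated G w \<rho> q C (X - Y) \<and>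
    real (card Y) powr (1 + 1 / real k) + real (card (X - C)) powr (1 + 1 / real k)
      \<le> real (card X) powr (1 + 1 / real k)"
  proof (intro exI conjI)
    show "v \<in> B j" "B j \<subseteq> B (Suc j)" by (simp_all add: vB mono)
    show "B (Suc j) \<subseteq> X \<inter> wball G w (real J * \<rho>) (J * q) v"
      using mono[of "Suc j" J] j(1) by (auto simp: B_def)
    show "separated G w \<rho> q (B j) (X - B (Suc j))" by (rule sep)
    show "real (card (B (Suc j))) powr (1 + 1 / real k) +
      real (card (X - B j)) powr (1 + 1 / real k) \<le> real (card X) powr (1 + 1 / real k)"
      using j(2) card_Diff_subset[OF finite_subset[OF BX finX] BX] by simp
  qed
qed

text \<open>At the lowest scale every walk between different vertices contains an edge of weight at
  least \<open>\<rho>\<close>, so single vertices can be removed without any duplication.\<close>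

lemma splittable_singletons:
  assumes fin: "finite (verts G)" and \<rho>: "\<And>e. e \<in> edges G \<Longrightarrow> \<rho> \<le> enn2real (w e)" and "0 \<le> a"
  shows "splittable G w (1 + a) \<rho> q (\<lambda>v. {v})"
  unfolding splittable_def
proof (intro allI impI)
  fix X v assume X: "X \<subseteq> verts G" "v \<in> X"
  have finX: "finite X" using X fin finite_subset by blast
  have sep: "separated G w \<rho> q {v} (X - {v})"
    unfolding separated_def
  proof (intro ballI allI impI)
    fix a b x assume "a \<in> {v}" "b \<in> X - {v}" "reach G w x q a b"
    then obtain p where p: "walk G p" "hd p = v" "last p = b" "len w p \<le> x" "b \<noteq> v"
      by (auto simp: reach_def)
    then obtain y z p' where p': "p = y # z # p'" by (cases p rule: walk_edges.cases) (auto simp: walk_def)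
    have "\<rho> \<le> enn2real (w {y, z})" using p(1) by (intro \<rho>) (simp add: p' walk_Cons)
    also have "\<dots> \<le> len w p" by (simp add: p')
    finally show "\<rho> \<le> x" using p by simp
  qed
  have "real (card X) = 1 + real (card (X - {v}))"
    using card_Suc_Diff1[OF finX X(2)] by linarith
  then have "real (card {v}) powr (1 + a) + real (card (X - {v})) powr (1 + a)
      \<le> real (card X) powr (1 + a)"
    using powr_superadditive[of 1 "real (card (X - {v}))" a] \<open>0 \<le> a\<close> by simp
  then show "\<exists>C Y. v \<in> C \<and> C \<subseteq> Y \<and> Y \<subseteq> X \<inter> {v} \<and> separated G w \<rho> q C (X - Y) \<and>
      real (card Y) powr (1 + a) + real (card (X - C)) powr (1 + a) \<le> real (card X) powr (1 + a)"
    using X sep by (intro exI[of _ "{v}"]) auto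
qed

text \<open>Level 0 consists of singletons instead of balls, so that its clusters are leaves and the
  recursion has a base case.\<close>

fun level_region ::
  "'a ugraph \<Rightarrow> ('a set \<Rightarrow> ennreal) \<Rightarrow> nat \<Rightarrow> nat \<Rightarrow> real \<Rightarrow> nat \<Rightarrow> 'a \<Rightarrow> 'a set" where
  "level_region G w J q \<rho> 0 v = {v}"
| "level_region G w J q \<rho> (Suc i) v = wball G w (real J * (2 ^ Suc i * \<rho>)) (J * q) v"

text \<open>The weights of the links on the way to the root form a geometric series, so at level
  \<open>i\<close> they are bounded by twice the last term, \<open>2 * J * (2 ^ i * \<rho>)\<close>.
  Passing from level \<open>i\<close> to the next adds twice the new bound, divided by the scale
  \<open>2 ^ i * \<rho>\<close> of the cuts, to the stretch. This is \<open>8 * J\<close>,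
  independently of \<open>i\<close>.\<close>

lemma link_tree_exists:
  assumes fin: "finite (verts G)" and k: "1 \<le> k" and m: "log 2 (real (card (verts G))) \<le> 2 ^ m"
    and \<rho>: "0 < \<rho>" "\<And>e. e \<in> edges G \<Longrightarrow> \<rho> \<le> enn2real (w e)" and J: "J = 2 * (k * m + 1)"
    and r: "r \<in> verts G"
  shows "\<exists>T. realisable G w (J * q) T \<and> depth T \<le> Suc L \<and> set (labels T) = verts G \<and>
    real (length (labels T)) \<le> real (card (verts G)) powr (1 + 1 / real k) \<and>
    count_list (labels T) r = 1 \<and>
    (\<forall>\<sigma>. \<sigma> \<noteq> [] \<longrightarrow> set \<sigma> \<subseteq> verts G \<longrightarrow> short_detours G w q \<sigma> \<longrightarrow> len w \<sigma> < 2 ^ L * \<rho> \<longrightarrow>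
      cover T (set \<sigma>) (8 * real J * real L * len w \<sigma>))"
proof -
  have "0 < J" using J by simp
  let ?p = "1 + 1 / real k" and ?R = "level_region G w J q \<rho>"
  have split: "splittable G w ?p (2 ^ i * \<rho>) q (?R i)" for i
  proof (cases i)
    case 0
    have "?R 0 = (\<lambda>v. {v})" by auto
    then show ?thesis using splittable_singletons[OF fin \<rho>(2)] 0 by simp
  next
    case (Suc i')
    have "?R i = wball G w (real J * (2 ^ i * \<rho>)) (J * q)" using Suc by (intro ext) simp
    then show ?thesis using splittable_wball[OF fin k m _ J] \<rho>(1) by simp
  qed
  have trees: "\<exists>t. cluster_tree G w ?p q (J * q) i (2 * real J * (2 ^ i * \<rho>)) (8 * real J * real i) Y y t"
    if "y \<in> Y" "Y \<subseteq> verts G \<inter> ?R i y" for i Y y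
    using that
  proof (induction i arbitrary: Y y)
    case 0
    then have Y: "Y = {y}" by auto
    have "set \<sigma> = {y}" if "\<sigma> \<noteq> []" "set \<sigma> \<subseteq> Y" for \<sigma> using that Y by (cases \<sigma>) auto
    then show ?case
      using 0 \<rho>(1) unfolding cluster_tree_def
      by (intro exI[of _ "Leaf y"]) (auto simp: Y)
  next
    case (Suc i)
    have "\<exists>t. cluster_tree G w ?p q (J * q) (Suc i)
        (2 * real J * (2 ^ i * \<rho>) + real J * (2 ^ Suc i * \<rho>))
        (8 * real J * real i + 2 * (2 * real J * (2 ^ i * \<rho>) + real J * (2 ^ Suc i * \<rho>)) / (2 ^ i * \<rho>))
        Y y t"
    proof (rule cluster_tree_Suc[OF fin split _ _ _ Suc.IH])
      show "reach G w (real J * (2 ^ Suc i * \<rho>)) (J * q) y u" if "u \<in> Y" for u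
        using Suc.prems that by (auto simp: wball_def)
      show "0 < real J * (2 ^ Suc i * \<rho>)" using \<rho>(1) \<open>0 < J\<close> by simp
    qed (use Suc.prems \<rho>(1) in auto)
    moreover have "2 * real J * (2 ^ i * \<rho>) + real J * (2 ^ Suc i * \<rho>) = 2 * real J * (2 ^ Suc i * \<rho>)"
      by simp
    moreover have "8 * real J * real i + 2 * (2 * real J * (2 ^ Suc i * \<rho>)) / (2 ^ i * \<rho>)
        = 8 * real J * real (Suc i)"
      using \<rho>(1) by (simp add: field_simps)
    ultimately show ?case by metis
  qed
  obtain t ts where root: "root t = r" and count: "count_list (concat (map labels (t # ts))) r = 1"
    and forest: "cluster_forest G w ?p (2 ^ L * \<rho>) q (J * q) L (2 * real J * (2 ^ L * \<rho>))
      (8 * real J * real L) (verts G) (t # ts)"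
    using cluster_forest[OF fin split[of L] _ trees order_refl r] by fastforce
  note forest = cluster_forestD[OF forest]
  \<comment> \<open>Infinite links carry no paths, but they count towards the depth; hence the bound
    \<open>Suc L\<close>.\<close>
  let ?T = "star \<infinity> t ts"
  show ?thesis
  proof (intro exI[of _ ?T] conjI allI impI)
    show "realisable G w (J * q) ?T" using forest(4) by (intro realisable_star) auto
    show "depth ?T \<le> Suc L" using forest(3) by (intro depth_star) auto
    show "set (labels ?T) = verts G" using forest(1) by (simp add: labels_star)
    show "real (length (labels ?T)) \<le> real (card (verts G)) powr ?p"
      using forest(2) by (simp add: labels_star)
    show "count_list (labels ?T) r = 1" using count by (simp add: labels_star)
    fix \<sigma> assume \<sigma>: "\<sigma> \<noteq> []" "set \<sigma> \<subseteq> verts G" "short_detours G w q \<sigma>" "len w \<sigma> < 2 ^ L * \<rho>"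
    then obtain m c where mc: "pieces (t # ts) (set \<sigma>) m c" "c \<le> 8 * real J * real L * len w \<sigma>"
      "real m * (2 ^ L * \<rho>) \<le> len w \<sigma>" using forest(6) by blast
    \<comment> \<open>The tour is too short to pay for even one cut at the top scale, so its cover
      never uses an infinite link.\<close>
    have "real m * (2 ^ L * \<rho>) < 1 * (2 ^ L * \<rho>)" using mc(3) \<sigma>(4) by linarith
    then have "m = 0" using \<rho>(1) by (subst (asm) mult_less_cancel_right_pos) auto
    then obtain s where s: "s \<in> set (t # ts)" "cover s (set \<sigma>) c" using mc(1) pieces_zero by blast
    have "cover ?T (set \<sigma>) c" by (rule cover_star[OF s])
    then show "cover ?T (set \<sigma>) (8 * real J * real L * len w \<sigma>)"
      using mc(2) by (rule cover_mono[OF _ order_refl])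
  qed
qed

section \<open>Tours through hop balls\<close>

definition wsum :: "('a set \<Rightarrow> ennreal) \<Rightarrow> 'a set set \<Rightarrow> real" where
  "wsum w F = (\<Sum>e\<in>F. enn2real (w e))"

lemma wsum_nonneg [simp]: "0 \<le> wsum w F"
  by (simp add: wsum_def sum_nonneg)

lemma wsum_mono: "finite F' \<Longrightarrow> F \<subseteq> F' \<Longrightarrow> wsum w F \<le> wsum w F'"
  unfolding wsum_def by (intro sum_mono2) auto

lemma wsum_insert: "finite F \<Longrightarrow> e \<notin> F \<Longrightarrow> wsum w (insert e F) = enn2real (w e) + wsum w F"
  by (simp add: wsum_def)

text \<open>The tour is extended by a leaf \<open>u\<close>, replacing an occurrence of its parent \<open>p\<close> by \<open>p, u, p\<close>.\<close>

lemma reach_leaf_insert: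
  assumes u: "u \<notin> set s1" "u \<notin> set s2" "u \<noteq> p"
    and edge: "{p, u} \<in> edges G" and V: "p \<in> verts G" "u \<in> verts G" and d: "d u = Suc (d p)"
    and old: "\<And>xs ys zs. s1 @ p # s2 = xs @ ys @ zs \<Longrightarrow> ys \<noteq> [] \<Longrightarrow>
      reach G w (len w ys) (d (hd ys) + d (last ys)) (hd ys) (last ys)"
    and new: "s1 @ p # u # p # s2 = xs @ ys @ zs" "ys \<noteq> []"
  shows "reach G w (len w ys) (d (hd ys) + d (last ys)) (hd ys) (last ys)"
proof -
  have up: "reach G w (enn2real (w {p, u})) 1 u p"
    unfolding reach_def using edge V
    by (intro exI[of _ "[u, p]"]) (simp add: walk_Cons insert_commute)
  consider "u \<in> set xs" | "u \<in> set zs" | "u \<in> set ys"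
    using new(1) by (metis Un_iff in_set_conv_decomp set_append append_Cons append_assoc)
  then show ?thesis
  proof cases
    case 1
    then obtain x1 x2 where x: "xs = x1 @ u # x2" by (meson split_list)
    have "(s1 @ [p]) @ u # (p # s2) = x1 @ u # (x2 @ ys @ zs)" using new(1) x by simp
    then have "p # s2 = x2 @ ys @ zs" using u by (subst (asm) append_Cons_eq_iff) auto
    then show ?thesis using old[of "s1 @ x2" ys zs] new(2) by simp
  next
    case 2
    then obtain z1 z2 where z: "zs = z1 @ u # z2" by (meson split_list)
    have "(s1 @ [p]) @ u # (p # s2) = (xs @ ys @ z1) @ u # z2" using new(1) z by simp
    then have "s1 @ [p] = xs @ ys @ z1" using u by (subst (asm) append_Cons_eq_iff) auto
    then have "s1 @ p # s2 = xs @ ys @ (z1 @ s2)"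
      by (metis append.assoc append_Cons append_Nil)
    then show ?thesis using old new(2) by blast
  next
    case 3
    then obtain y1 y2 where y: "ys = y1 @ u # y2" by (meson split_list)
    have "(s1 @ [p]) @ u # (p # s2) = (xs @ y1) @ u # (y2 @ zs)" using new(1) y by simp
    then have eq: "xs @ y1 = s1 @ [p]" "y2 @ zs = p # s2"
      using u by (subst (asm) append_Cons_eq_iff; auto)+
    have left: "\<exists>a. y1 = a @ [p] \<and> s1 = xs @ a" if "y1 \<noteq> []"
      using that eq(1) by (metis append_butlast_last_id append_assoc butlast_append butlast_snoc last_appendR last_snoc)
    have right: "\<exists>b. y2 = p # b \<and> s2 = b @ zs" if "y2 \<noteq> []"
      using that eq(2) by (cases y2) auto
    consider "y1 = []" "y2 = []" | b where "y1 = []" "y2 = p # b" "s2 = b @ zs"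
      | a where "y1 = a @ [p]" "s1 = xs @ a" "y2 = []"
      | a b where "y1 = a @ [p]" "s1 = xs @ a" "y2 = p # b" "s2 = b @ zs"
      using left right by blast
    then show ?thesis
    proof cases
      case 1
      then show ?thesis using V by (simp add: y reach_refl)
    next
      case 2
      \<comment> \<open>The additional hop between \<open>u\<close> and \<open>p\<close> is exactly
        what \<open>d u = Suc (d p)\<close> permits.\<close>
      have "reach G w (len w (p # b)) (d p + d (last (p # b))) p (last (p # b))"
        using old[of s1 "p # b" zs] 2 by simp
      from reach_trans[OF up this] show ?thesis using 2 d by (simp add: y insert_commute)
    next
      case 3
      have "reach G w (len w (a @ [p])) (d (hd (a @ [p])) + d p) (hd (a @ [p])) p"
        using old[of xs "a @ [p]" s2] 3 by simp
      from reach_trans[OF this reach_sym[OF up]] show ?thesis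
        using 3 d len_split[of w a p "[u]"] by (cases a) (simp_all add: y add.commute)
    next
      case 4
      \<comment> \<open>Here \<open>u\<close> is strictly inside: skipping the excursion keeps both
        ends and only shortens the infix, so the old walk still qualifies.\<close>
      have r: "reach G w (len w (a @ p # b)) (d (hd (a @ p # b)) + d (last (a @ p # b)))
          (hd (a @ p # b)) (last (a @ p # b))"
        using old[of xs "a @ p # b" zs] 4 by simp
      have "len w ys = len w (a @ [p]) + len w (p # u # p # b)"
        using len_split[of w a p "u # p # b"] 4 by (simp add: y)
      then have "len w (a @ p # b) \<le> len w ys" using len_split[of w a p b] by simp
      moreover have "hd (a @ p # b) = hd ys" "last (a @ p # b) = last ys"
        using 4 by (simp_all add: y hd_append)
      ultimately show ?thesis using reach_mono[OF r _ order_refl] by simp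
    qed
  qed
qed

text \<open>A vertex with the largest \<open>d\<close> is a leaf of the tree of parents. It is
  removed, the rest is toured by induction, and the leaf is put back as an excursion that uses its
  edge twice, whence the factor 2.\<close>

lemma tree_tour:
  assumes fin: "finite F" and F: "F \<subseteq> edges G"
  shows "finite U \<Longrightarrow> v \<in> U \<Longrightarrow> U \<subseteq> verts G \<Longrightarrow>
    (\<And>u. u \<in> U - {v} \<Longrightarrow> \<exists>p\<in>U. {p, u} \<in> F \<and> d u = Suc (d p)) \<Longrightarrow>
    \<exists>\<sigma>. set \<sigma> = U \<and> len w \<sigma> \<le> 2 * wsum w {e \<in> F. e \<subseteq> U} \<and>
      (\<forall>xs ys zs. \<sigma> = xs @ ys @ zs \<longrightarrow> ys \<noteq> [] \<longrightarrow>
        reach G w (len w ys) (d (hd ys) + d (last ys)) (hd ys) (last ys))"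
proof (induction "card U" arbitrary: U rule: less_induct)
  case less
  show ?case
  proof (cases "U = {v}")
    case True
    have "reach G w (len w ys) (d (hd ys) + d (last ys)) (hd ys) (last ys)"
      if "[v] = xs @ ys @ zs" "ys \<noteq> []" for xs ys zs
    proof -
      have "ys = [v]" using that by (cases xs; cases ys) auto
      then show ?thesis using less.prems by (auto intro: reach_refl)
    qed
    then show ?thesis using True by (intro exI[of _ "[v]"]) simp
  next
    case False
    then have ne: "U - {v} \<noteq> {}" using less.prems by blast
    have fU: "finite (d ` (U - {v}))" using less.prems by simp
    have "Max (d ` (U - {v})) \<in> d ` (U - {v})" using Max_in[OF fU] ne by blast
    then obtain u where "u \<in> U - {v}" and u_Max: "d u = Max (d ` (U - {v}))" by (metis imageE)
    then have u: "u \<in> U" "u \<noteq> v" by auto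
    have umax: "d x \<le> d u" if "x \<in> U - {v}" for x
      using Max_ge[OF fU] that by (simp add: u_Max)
    obtain p where p: "p \<in> U" "{p, u} \<in> F" "d u = Suc (d p)" using less.prems(4) u by blast
    have "\<exists>\<sigma>. set \<sigma> = U - {u} \<and> len w \<sigma> \<le> 2 * wsum w {e \<in> F. e \<subseteq> U - {u}} \<and>
      (\<forall>xs ys zs. \<sigma> = xs @ ys @ zs \<longrightarrow> ys \<noteq> [] \<longrightarrow>
        reach G w (len w ys) (d (hd ys) + d (last ys)) (hd ys) (last ys))"
    proof (rule less.hyps)
      show "card (U - {u}) < card U" using u less.prems(1) by (intro psubset_card_mono) auto
      fix x assume x: "x \<in> U - {u} - {v}"
      then obtain y where "y \<in> U" "{y, x} \<in> F" "d x = Suc (d y)" using less.prems(4) by blast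
      \<comment> \<open>A child of \<open>u\<close> would have a larger value of \<open>d\<close>,
        so nobody loses its parent when \<open>u\<close> is removed.\<close>
      moreover from this have "y \<noteq> u" using umax[of x] x by auto
      ultimately show "\<exists>p\<in>U - {u}. {p, x} \<in> F \<and> d x = Suc (d p)" by blast
    qed (use less.prems u in auto)
    then obtain \<sigma> where \<sigma>: "set \<sigma> = U - {u}" "len w \<sigma> \<le> 2 * wsum w {e \<in> F. e \<subseteq> U - {u}}"
      "\<And>xs ys zs. \<sigma> = xs @ ys @ zs \<Longrightarrow> ys \<noteq> [] \<Longrightarrow>
        reach G w (len w ys) (d (hd ys) + d (last ys)) (hd ys) (last ys)" by blast
    have "p \<noteq> u" using p(3) by auto
    then have "p \<in> set \<sigma>" using \<sigma>(1) p(1) by blast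
    then obtain s1 s2 where s: "\<sigma> = s1 @ p # s2" by (meson split_list)
    show ?thesis
    proof (intro exI[of _ "s1 @ p # u # p # s2"] conjI allI impI)
      show "set (s1 @ p # u # p # s2) = U" using \<sigma>(1) u(1) by (auto simp: s)
      have "wsum w (insert {p, u} {e \<in> F. e \<subseteq> U - {u}}) \<le> wsum w {e \<in> F. e \<subseteq> U}"
        using fin p u by (intro wsum_mono) auto
      then have "enn2real (w {p, u}) + wsum w {e \<in> F. e \<subseteq> U - {u}} \<le> wsum w {e \<in> F. e \<subseteq> U}"
        using fin by (subst (asm) wsum_insert) auto
      moreover have "len w (s1 @ p # u # p # s2) = len w \<sigma> + 2 * enn2real (w {p, u})"
        using len_split[of w s1 p s2] len_split[of w s1 p "u # p # s2"]
        by (simp add: s insert_commute)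
      ultimately show "len w (s1 @ p # u # p # s2) \<le> 2 * wsum w {e \<in> F. e \<subseteq> U}"
        using \<sigma>(2) by linarith
      fix xs ys zs assume "s1 @ p # u # p # s2 = xs @ ys @ zs" "ys \<noteq> []"
      then show "reach G w (len w ys) (d (hd ys) + d (last ys)) (hd ys) (last ys)"
      proof (rule reach_leaf_insert[rotated -2])
        show "u \<notin> set s1" "u \<notin> set s2" using \<sigma>(1) by (auto simp: s)
        show "{p, u} \<in> edges G" "p \<in> verts G" "u \<in> verts G" using F p u less.prems by auto
        show "reach G w (len w ys) (d (hd ys) + d (last ys)) (hd ys) (last ys)"
          if "s1 @ p # s2 = xs @ ys @ zs" "ys \<noteq> []" for xs ys zs
          using \<sigma>(3) that s by blast
      qed (use p \<open>p \<noteq> u\<close> in auto)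
    qed
  qed
qed

section \<open>Hop balls and region growing\<close>

definition hop_ball :: "'a set \<Rightarrow> 'a set set \<Rightarrow> 'a \<Rightarrow> nat \<Rightarrow> 'a set" where
  "hop_ball V F v t =
     {u. \<exists>p. walk \<lparr>verts = V, edges = F\<rparr> p \<and> hd p = v \<and> last p = u \<and> hop p \<le> t}"

lemma hop_ball_center: "v \<in> V \<Longrightarrow> v \<in> hop_ball V F v t"
  unfolding hop_ball_def by (auto intro!: exI[of _ "[v]"])

lemma hop_ball_subset: "hop_ball V F v t \<subseteq> V"
  unfolding hop_ball_def walk_def by auto

lemma hop_ball_add:
  assumes "u \<in> hop_ball V F v t" "walk \<lparr>verts = V, edges = F\<rparr> p" "hd p = u" "hop p \<le> h"
  shows "last p \<in> hop_ball V F v (t + h)"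
proof -
  obtain q where "walk \<lparr>verts = V, edges = F\<rparr> q" "hd q = v" "last q = u" "hop q \<le> t"
    using assms(1) by (auto simp: hop_ball_def)
  then show ?thesis
    using assms unfolding hop_ball_def
    by (intro CollectI exI[of _ "walk_join q p"]) (simp add: walk_join_props walk_nonempty)
qed

lemma hop_ball_parent:
  assumes "u \<in> hop_ball V F v (Suc t)" "u \<notin> hop_ball V F v t"
  shows "\<exists>p\<in>hop_ball V F v t. {p, u} \<in> F"
proof -
  let ?H = "\<lparr>verts = V, edges = F\<rparr>"
  obtain q where q: "walk ?H q" "hd q = v" "last q = u" "hop q \<le> Suc t"
    using assms(1) by (auto simp: hop_ball_def)
  have "\<not> hop q \<le> t" using assms(2) q by (auto simp: hop_ball_def)
  then have "length q \<ge> 2" using q by (simp add: hop_conv_length)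
  then obtain q' where q': "q = q' @ [u]" "q' \<noteq> []"
    using q(3) by (cases q rule: rev_cases) (auto simp: Suc_le_length_iff)
  then obtain a x where a: "q' = a @ [x]" by (cases q' rule: rev_cases) auto
  have "walk ?H q'" "{x, u} \<in> F"
    using q(1) walk_split[of ?H a x "[u]"] by (simp_all add: q' a walk_Cons)
  moreover have "hop q' \<le> t" using q(4) by (simp add: q' a hop_conv_length)
  ultimately show ?thesis
    using q(2) q'(2) by (intro bexI[of _ x]) (auto simp: hop_ball_def q' a hd_append)
qed

text \<open>The tour follows a breadth-first tree, \<open>d\<close> being the level of a vertex.
  Levels are at most \<open>t\<close>, and the hops between two vertices of the tour are bounded by
  the sum of their levels.\<close>

lemma hop_ball_tour:
  assumes G: "graph G" and F: "F \<subseteq> edges G" "finite F" and v: "v \<in> verts G"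
  shows "\<exists>\<sigma>. set \<sigma> = hop_ball (verts G) F v t \<and>
    len w \<sigma> \<le> 2 * wsum w {e \<in> F. e \<subseteq> hop_ball (verts G) F v t} \<and> short_detours G w (2 * t) \<sigma>"
proof -
  let ?B = "hop_ball (verts G) F v"
  define d where "d u = (LEAST i. u \<in> ?B i)" for u
  have d: "u \<in> ?B (d u)" "d u \<le> i" if "u \<in> ?B i" for u i
    using that unfolding d_def by (auto intro: LeastI Least_le)
  have mono: "?B i \<subseteq> ?B j" if "i \<le> j" for i j
    using that order_trans unfolding hop_ball_def by blast
  have "\<exists>\<sigma>. set \<sigma> = ?B t \<and> len w \<sigma> \<le> 2 * wsum w {e \<in> F. e \<subseteq> ?B t} \<and>
      (\<forall>xs ys zs. \<sigma> = xs @ ys @ zs \<longrightarrow> ys \<noteq> [] \<longrightarrow>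
        reach G w (len w ys) (d (hd ys) + d (last ys)) (hd ys) (last ys))"
  proof (rule tree_tour[OF F(2,1)])
    show "?B t \<subseteq> verts G" by (rule hop_ball_subset)
    then show "finite (?B t)" using G by (auto simp: graph_def intro: finite_subset)
    show "v \<in> ?B t" using v by (rule hop_ball_center)
    fix u assume u: "u \<in> ?B t - {v}"
    have "u \<notin> ?B 0"
    proof
      assume "u \<in> ?B 0"
      then obtain q where "walk \<lparr>verts = verts G, edges = F\<rparr> q" "hd q = v" "last q = u" "hop q = 0"
        by (auto simp: hop_ball_def)
      then show False using u by (cases q rule: walk_edges.cases) (auto simp: walk_def)
    qed
    then obtain i where i: "d u = Suc i" using d(1)[of u t] u by (cases "d u") auto
    have "u \<in> ?B (Suc i)" using d(1)[of u t] u i by simp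
    moreover have "u \<notin> ?B i" using d(2)[of u i] i by auto
    ultimately obtain p where p: "p \<in> ?B i" "{p, u} \<in> F" using hop_ball_parent by metis
    have "i \<le> t" using d(2)[of u t] u i by simp
    have "d p \<le> i" using d(2) p(1) by blast
    moreover have "Suc i \<le> Suc (d p)"
    proof -
      have "u \<in> ?B (d p + 1)"
        using hop_ball_add[OF d(1)[OF p(1)], of "[p, u]" 1] p(2) hop_ball_subset[of "verts G" F v i]
          hop_ball_subset[of "verts G" F v t] u p(1)
        by (auto simp: walk_Cons)
      then show ?thesis using d(2)[of u] i by fastforce
    qed
    ultimately have "d u = Suc (d p)" using i by simp
    then show "\<exists>p\<in>?B t. {p, u} \<in> F \<and> d u = Suc (d p)"
      using p mono[OF \<open>i \<le> t\<close>] by blast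
  qed
  then obtain \<sigma> where \<sigma>: "set \<sigma> = ?B t" "len w \<sigma> \<le> 2 * wsum w {e \<in> F. e \<subseteq> ?B t}"
    and r: "\<And>xs ys zs. \<sigma> = xs @ ys @ zs \<Longrightarrow> ys \<noteq> [] \<Longrightarrow>
      reach G w (len w ys) (d (hd ys) + d (last ys)) (hd ys) (last ys)" by blast
  have "short_detours G w (2 * t) \<sigma>"
    unfolding short_detours_def
  proof (intro allI impI)
    fix xs ys zs assume y: "\<sigma> = xs @ ys @ zs" "ys \<noteq> []"
    have "hd ys \<in> ?B t" "last ys \<in> ?B t"
      unfolding \<sigma>(1)[symmetric] using y by auto
    then have "d (hd ys) + d (last ys) \<le> 2 * t" using d(2) by (metis add_mono mult_2)
    then show "reach G w (len w ys) (2 * t) (hd ys) (last ys)"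
      using reach_mono[OF r[OF y] order_refl] by blast
  qed
  then show ?thesis using \<sigma> by blast
qed

text \<open>Otherwise \<open>L\<close> doublings would raise the initial value \<open>\<rho>\<close>
  to at least \<open>2 ^ L * \<rho>\<close>.\<close>

lemma doubling_step_exists:
  fixes W :: "nat \<Rightarrow> real"
  assumes "\<rho> \<le> W 0" "W L < 2 ^ L * \<rho>"
  shows "\<exists>j<L. W (Suc j) \<le> 2 * W j"
proof (rule ccontr)
  assume "\<not> ?thesis"
  then have step: "2 * W j \<le> W (Suc j)" if "j < L" for j using that by (auto simp: not_le less_imp_le)
  have "2 ^ j * \<rho> \<le> W j" if "j \<le> L" for j
    using that
  proof (induction j)
    case (Suc j)
    then show ?case using step[of j] by simp
  qed (use assms in simp)
  then show False using assms(2) by fastforce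
qed

text \<open>Region growing: a hop ball is cut off where the weight of the incident edges at most doubles
  while its radius grows by \<open>h\<close>. Removing only the edges meeting the smaller ball makes the total
  weight of the larger balls proportional to \<open>wsum w F\<close>.\<close>

lemma covering_tours:
  assumes G: "graph G" and w: "0 < \<rho>" "\<And>e. e \<in> edges G \<Longrightarrow> \<rho> \<le> enn2real (w e)"
    and L: "wsum w (edges G) < 2 ^ L * \<rho>" and finE: "finite (edges G)"
  shows "F \<subseteq> edges G \<Longrightarrow> \<exists>\<Sigma>.
    (\<forall>\<sigma>\<in>set \<Sigma>. \<sigma> \<noteq> [] \<and> set \<sigma> \<subseteq> verts G \<and> short_detours G w (2 * (L * h)) \<sigma> \<and>
      len w \<sigma> \<le> 2 * wsum w F) \<and>
    (\<Sum>\<sigma>\<leftarrow>\<Sigma>. len w \<sigma>) \<le> 4 * wsum w F \<and>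
    (\<forall>p. walk \<lparr>verts = verts G, edges = F\<rparr> p \<longrightarrow> 0 < hop p \<longrightarrow> hop p \<le> h \<longrightarrow>
      (\<exists>\<sigma>\<in>set \<Sigma>. hd p \<in> set \<sigma> \<and> last p \<in> set \<sigma>))"
proof (induction "card F" arbitrary: F rule: less_induct)
  case less
  have finF: "finite F" using less.prems finE finite_subset by blast
  show ?case
  proof (cases "F = {}")
    case True
    have "hop p = 0" if "walk \<lparr>verts = verts G, edges = {}\<rparr> p" for p
      using that by (auto simp: walk_def hop_def)
    then show ?thesis using True by (intro exI[of _ "[]"]) auto
  next
    case False
    then obtain e where e: "e \<in> F" by blast
    have eG: "e \<subseteq> verts G" "e \<noteq> {}" if "e \<in> F" for e
      using that G less.prems by (fastforce simp: graph_def)+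
    obtain v where v: "v \<in> e" using eG e by blast
    have vG: "v \<in> verts G" using v eG e by blast
    let ?B = "hop_ball (verts G) F v"
    \<comment> \<open>Incident edges instead of inner ones: once they are removed, every remaining
      walk with an edge avoids the ball, and the centre alone already contributes an edge, so the
      weight starts at \<open>\<rho>\<close> or more.\<close>
    define I where "I t = {e \<in> F. e \<inter> ?B t \<noteq> {}}" for t
    have IF: "I t \<subseteq> F" for t by (auto simp: I_def)
    have "e \<in> I 0" using e v hop_ball_center[OF vG] by (auto simp: I_def)
    have "\<rho> \<le> enn2real (w e)" using w e less.prems by blast
    also have "\<dots> \<le> wsum w (I 0)"
      using wsum_mono[of "I 0" "{e}" w] \<open>e \<in> I 0\<close> finF IF by (auto simp: wsum_def intro: finite_subset)
    finally have "\<rho> \<le> wsum w (I (0 * h))" by simp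
    moreover have "wsum w (I (L * h)) < 2 ^ L * \<rho>"
      using wsum_mono[OF finE, of "I (L * h)" w] IF[of "L * h"] less.prems L by fastforce
    ultimately obtain j where j: "j < L" "wsum w (I (Suc j * h)) \<le> 2 * wsum w (I (j * h))"
      using doubling_step_exists[of \<rho> "\<lambda>j. wsum w (I (j * h))" L] by blast
    obtain \<sigma> where \<sigma>: "set \<sigma> = ?B (Suc j * h)"
      "len w \<sigma> \<le> 2 * wsum w {e \<in> F. e \<subseteq> ?B (Suc j * h)}" "short_detours G w (2 * (Suc j * h)) \<sigma>"
      using hop_ball_tour[OF G less.prems finF vG, of "Suc j * h" w] by (elim exE conjE)
    have "{e \<in> F. e \<subseteq> ?B (Suc j * h)} \<subseteq> I (Suc j * h)" using eG(2) unfolding I_def by blast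
    then have "wsum w {e \<in> F. e \<subseteq> ?B (Suc j * h)} \<le> wsum w (I (Suc j * h))"
      using finF IF by (intro wsum_mono) (auto intro: finite_subset)
    \<comment> \<open>One factor 2 is due to the tour, the other to the doubling step; the edges
      \<open>I (j * h)\<close> that pay are then deleted, so none pays twice.\<close>
    then have len4: "len w \<sigma> \<le> 4 * wsum w (I (j * h))" using \<sigma>(2) j(2) by linarith
    \<comment> \<open>This bound on a single tour, as opposed to their sum, is what keeps each tour
      below the top scale of the hierarchy.\<close>
    have "wsum w {e \<in> F. e \<subseteq> ?B (Suc j * h)} \<le> wsum w F" using finF by (intro wsum_mono) auto
    then have len2: "len w \<sigma> \<le> 2 * wsum w F" using \<sigma>(2) by linarith
    have sd: "short_detours G w (2 * (L * h)) \<sigma>"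
      using \<sigma>(3) j(1) by (elim short_detours_mono) (intro mult_le_mono, auto)
    define F' where "F' = F - I (j * h)"
    have F': "F' \<subseteq> F" "wsum w F = wsum w (I (j * h)) + wsum w F'"
      using sum.subset_diff[OF IF finF] by (auto simp: F'_def wsum_def add.commute)
    have "e \<in> I (j * h)" using e v hop_ball_center[OF vG] by (auto simp: I_def)
    then have "card F' < card F" using finF e by (intro psubset_card_mono) (auto simp: F'_def)
    moreover have "F' \<subseteq> edges G" using F' less.prems by blast
    ultimately obtain \<Sigma> where
      \<Sigma>: "\<And>\<sigma>. \<sigma> \<in> set \<Sigma> \<Longrightarrow> \<sigma> \<noteq> [] \<and> set \<sigma> \<subseteq> verts G \<and> short_detours G w (2 * (L * h)) \<sigma> \<and>
          len w \<sigma> \<le> 2 * wsum w F'" "(\<Sum>\<sigma>\<leftarrow>\<Sigma>. len w \<sigma>) \<le> 4 * wsum w F'"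
      and cov: "\<And>p. walk \<lparr>verts = verts G, edges = F'\<rparr> p \<Longrightarrow> 0 < hop p \<Longrightarrow> hop p \<le> h \<Longrightarrow>
          \<exists>\<sigma>\<in>set \<Sigma>. hd p \<in> set \<sigma> \<and> last p \<in> set \<sigma>"
      using less.hyps[of F'] by blast
    show ?thesis
    proof (intro exI[of _ "\<sigma> # \<Sigma>"] conjI ballI allI impI)
      have "v \<in> set \<sigma>" using \<sigma>(1) hop_ball_center[OF vG] by blast
      then have ne: "\<sigma> \<noteq> []" by auto
      have sub: "set \<sigma> \<subseteq> verts G" using \<sigma>(1) hop_ball_subset by metis
      fix \<tau> assume \<tau>: "\<tau> \<in> set (\<sigma> # \<Sigma>)"
      show "\<tau> \<noteq> []" "set \<tau> \<subseteq> verts G" "short_detours G w (2 * (L * h)) \<tau>"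
        using \<tau> ne sub sd \<Sigma>(1) by auto
      have "wsum w F' \<le> wsum w F" using F' finF by (intro wsum_mono) auto
      then show "len w \<tau> \<le> 2 * wsum w F" using \<tau> len2 \<Sigma>(1)[of \<tau>] by auto
    next
      show "(\<Sum>\<sigma>\<leftarrow>\<sigma> # \<Sigma>. len w \<sigma>) \<le> 4 * wsum w F" using len4 \<Sigma>(2) F'(2) by simp
    next
      fix p assume p: "walk \<lparr>verts = verts G, edges = F\<rparr> p" "0 < hop p" "hop p \<le> h"
      show "\<exists>\<sigma>\<in>set (\<sigma> # \<Sigma>). hd p \<in> set \<sigma> \<and> last p \<in> set \<sigma>"
      proof (cases "set (walk_edges p) \<subseteq> F'")
        case True
        then have "walk \<lparr>verts = verts G, edges = F'\<rparr> p" using p(1) by (simp add: walk_def)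
        then show ?thesis using cov p by auto
      next
        \<comment> \<open>A walk using a deleted edge visits the smaller ball. Having at most
          \<open>h\<close> hops, it has both of its ends in the larger ball and thus on the new
          tour.\<close>
        case False
        then obtain f z where "f \<in> set (walk_edges p)" "z \<in> f" "z \<in> ?B (j * h)"
          using p(1) by (auto simp: F'_def I_def walk_def)
        then obtain a b where ab: "p = a @ z # b"
          using walk_edges_subset[of f p] split_list[of z p] by blast
        have "walk \<lparr>verts = verts G, edges = F\<rparr> (a @ [z])" "walk \<lparr>verts = verts G, edges = F\<rparr> (z # b)"
          using p(1) walk_split[of _ a z b] unfolding ab by simp_all
        moreover have "hop (rev (a @ [z])) \<le> h" "hop (z # b) \<le> h"
          using p(3) by (simp_all only: hop_rev) (auto simp: ab hop_conv_length)
        ultimately have "last (rev (a @ [z])) \<in> ?B (j * h + h)" "last (z # b) \<in> ?B (j * h + h)"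
          using \<open>z \<in> ?B (j * h)\<close>
          by (intro hop_ball_add[of z]; simp del: rev_append add: hd_rev)+
        moreover have "last (rev (a @ [z])) = hd p" by (cases a) (auto simp: ab last_rev)
        moreover have "last (z # b) = last p" by (simp add: ab)
        ultimately show ?thesis using \<sigma>(1) by (auto simp: add.commute)
      qed
    qed
  qed
qed

section \<open>Link trees as graphs\<close>

text \<open>Without repeated vertices the bridge is crossed at most once, since returning would mean
  visiting one of its ends again.\<close>

lemma bridge_walk:
  assumes A: "\<And>e. e \<in> edges A \<Longrightarrow> e \<subseteq> verts A" and B: "\<And>e. e \<in> edges B \<Longrightarrow> e \<subseteq> verts B"
    and disj: "verts A \<inter> verts B = {}" and a: "a \<in> verts A" and b: "b \<in> verts B"
    and G: "G = \<lparr>verts = verts A \<union> verts B, edges = insert {a, b} (edges A \<union> edges B)\<rparr>"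
  shows "walk G p \<Longrightarrow> distinct p \<Longrightarrow> walk A p \<or> walk B p \<or>
    (\<exists>p1 p2. p = p1 @ p2 \<and> walk A p1 \<and> last p1 = a \<and> walk B p2 \<and> hd p2 = b) \<or>
    (\<exists>p1 p2. p = p1 @ p2 \<and> walk B p1 \<and> last p1 = b \<and> walk A p2 \<and> hd p2 = a)"
proof (induction p rule: walk_edges.induct)
  case (1 x y p)
  have w: "{x, y} \<in> edges G" "walk G (y # p)" "distinct (y # p)" "x \<notin> set (y # p)"
    using "1.prems" by (auto simp: walk_Cons)
  have e: "{x, y} = {a, b} \<or> {x, y} \<in> edges A \<or> {x, y} \<in> edges B" using w(1) G by auto
  have eA: "x \<in> verts A" "y \<in> verts A" if "{x, y} \<in> edges A" using A[OF that] by auto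
  have eB: "x \<in> verts B" "y \<in> verts B" if "{x, y} \<in> edges B" using B[OF that] by auto
  have hd_verts: "hd q \<in> verts K" if "walk K q" for K :: "'a ugraph" and q
    using that by (cases q) (auto simp: walk_def)
  consider "walk A (y # p)" | "walk B (y # p)"
    | p1 p2 where "y # p = p1 @ p2" "walk A p1" "last p1 = a" "walk B p2" "hd p2 = b"
    | p1 p2 where "y # p = p1 @ p2" "walk B p1" "last p1 = b" "walk A p2" "hd p2 = a"
    using "1.IH" w by blast
  then show ?case
  proof cases
    case 1
    have yA: "y \<in> verts A" using hd_verts[OF 1] by simp
    show ?thesis
    proof (cases "{x, y} \<in> edges A")
      case True
      then show ?thesis using 1 eA by (simp add: walk_Cons)
    next
      case False
      then have "{x, y} = {a, b}" using e eB yA disj by blast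
      then have "y = a" "x = b" using yA b disj by (auto simp: doubleton_eq_iff)
      then have "x # y # p = [b] @ (y # p) \<and> walk B [b] \<and> last [b] = b \<and> walk A (y # p) \<and> hd (y # p) = a"
        using 1 b by simp
      then show ?thesis by blast
    qed
  next
    case 2
    have yB: "y \<in> verts B" using hd_verts[OF 2] by simp
    show ?thesis
    proof (cases "{x, y} \<in> edges B")
      case True
      then show ?thesis using 2 eB by (simp add: walk_Cons)
    next
      case False
      then have "{x, y} = {a, b}" using e eA yB disj by blast
      then have "y = b" "x = a" using yB a disj by (auto simp: doubleton_eq_iff)
      then have "x # y # p = [a] @ (y # p) \<and> walk A [a] \<and> last [a] = a \<and> walk B (y # p) \<and> hd (y # p) = b"
        using 2 a by simp
      then show ?thesis by blast
    qed
  next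
    case 3
    then obtain p1' where p1: "p1 = y # p1'" by (cases p1) (auto simp: walk_def)
    have yA: "y \<in> verts A" using hd_verts[OF 3(2)] p1 by simp
    have "{x, y} \<in> edges A"
    proof (rule ccontr)
      assume "{x, y} \<notin> edges A"
      then have "{x, y} = {a, b}" using e eB yA disj by blast
      then have "x = b" using yA b disj by (auto simp: doubleton_eq_iff)
      moreover have "b \<in> set p2" using 3(4,5) by (auto simp: walk_def)
      ultimately show False using w(4) 3(1) by auto
    qed
    then have "x # y # p = (x # p1) @ p2 \<and> walk A (x # p1) \<and> last (x # p1) = a \<and> walk B p2 \<and> hd p2 = b"
      using 3 eA p1 by (auto simp: walk_Cons)
    then show ?thesis by blast
  next
    case 4
    then obtain p1' where p1: "p1 = y # p1'" by (cases p1) (auto simp: walk_def)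
    have yB: "y \<in> verts B" using hd_verts[OF 4(2)] p1 by simp
    have "{x, y} \<in> edges B"
    proof (rule ccontr)
      assume "{x, y} \<notin> edges B"
      then have "{x, y} = {a, b}" using e eA yB disj by blast
      then have "x = a" using yB a disj by (auto simp: doubleton_eq_iff)
      moreover have "a \<in> set p2" using 4(4,5) by (auto simp: walk_def)
      ultimately show False using w(4) 4(1) by auto
    qed
    then have "x # y # p = (x # p1) @ p2 \<and> walk B (x # p1) \<and> last (x # p1) = b \<and> walk A p2 \<and> hd p2 = a"
      using 4 eB p1 by (auto simp: walk_Cons)
    then show ?thesis by blast
  qed
next
  case ("2_1")
  then show ?case by (simp add: walk_def)
next
  case ("2_2" x)
  then show ?case using G by auto
qed

lemma distinct_hd_eq_last: "distinct p \<Longrightarrow> p \<noteq> [] \<Longrightarrow> hd p = last p \<Longrightarrow> p = [hd p]"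
  by (cases p; cases "tl p = []") (auto dest: last_in_set)

lemma bridge_acyclic:
  assumes A: "\<And>e. e \<in> edges A \<Longrightarrow> e \<subseteq> verts A" and B: "\<And>e. e \<in> edges B \<Longrightarrow> e \<subseteq> verts B"
    and disj: "verts A \<inter> verts B = {}" and a: "a \<in> verts A" and b: "b \<in> verts B"
    and G: "G = \<lparr>verts = verts A \<union> verts B, edges = insert {a, b} (edges A \<union> edges B)\<rparr>"
    and acyclic: "\<nexists>p. cycle A p" "\<nexists>p. cycle B p"
  shows "\<not> cycle G p"
proof
  assume "cycle G p"
  then have p: "walk G p" "distinct p" "3 \<le> length p" "{last p, hd p} \<in> edges G"
    by (auto simp: cycle_def)
  have e: "{last p, hd p} = {a, b} \<or> {last p, hd p} \<in> edges A \<or> {last p, hd p} \<in> edges B"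
    using p(4) G by auto
  have ends: "hd q \<in> verts K" "last q \<in> verts K" "q \<noteq> []" if "walk K q" for K :: "'a ugraph" and q
    using that by (auto simp: walk_def)
  \<comment> \<open>If the walk crosses the bridge and the closing edge is the bridge as well, then
    each half starts and ends at the same end of the bridge. Both halves are single vertices, which
    is too short for a cycle.\<close>
  have crossing: False
    if "p = p1 @ p2" "walk C p1" "last p1 = c" "walk D p2" "hd p2 = d" "verts C \<inter> verts D = {}"
      "{last p, hd p} = {c, d}" "c \<in> verts C" "d \<in> verts D"
    for C D :: "'a ugraph" and p1 p2 c d
  proof -
    have "hd p = hd p1" "last p = last p2" using that(1) ends(3)[OF that(2)] ends(3)[OF that(4)] by auto
    then have "hd p1 = c" "last p2 = d"
      using that ends[OF that(2)] ends[OF that(4)] by (auto simp: doubleton_eq_iff)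
    then have "p1 = [c]" "p2 = [d]"
      using distinct_hd_eq_last[of p1] distinct_hd_eq_last[of p2] that p(2) ends(3) by auto
    then show False using p(3) that(1) by simp
  qed
  consider "walk A p" | "walk B p"
    | p1 p2 where "p = p1 @ p2" "walk A p1" "last p1 = a" "walk B p2" "hd p2 = b"
    | p1 p2 where "p = p1 @ p2" "walk B p1" "last p1 = b" "walk A p2" "hd p2 = a"
    using bridge_walk[OF A B disj a b G p(1,2)] by blast
  then show False
  proof cases
    case 1
    then have v: "hd p \<in> verts A" "last p \<in> verts A" using ends by auto
    then have "b \<notin> {last p, hd p}" using b disj by blast
    then have "{last p, hd p} \<noteq> {a, b}" by blast
    moreover have "{last p, hd p} \<notin> edges B" using B[of "{last p, hd p}"] v disj by blast
    ultimately have "{last p, hd p} \<in> edges A" using e by blast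
    then show False using acyclic p 1 by (auto simp: cycle_def)
  next
    case 2
    then have v: "hd p \<in> verts B" "last p \<in> verts B" using ends by auto
    then have "a \<notin> {last p, hd p}" using a disj by blast
    then have "{last p, hd p} \<noteq> {a, b}" by blast
    moreover have "{last p, hd p} \<notin> edges A" using A[of "{last p, hd p}"] v disj by blast
    ultimately have "{last p, hd p} \<in> edges B" using e by blast
    then show False using acyclic p 2 by (auto simp: cycle_def)
  next
    case 3
    have "hd p \<in> verts A" "last p \<in> verts B"
      using 3 ends(1)[OF 3(2)] ends(2)[OF 3(4)] ends(3)[OF 3(2)] ends(3)[OF 3(4)] by auto
    then have "{last p, hd p} \<notin> edges A" "{last p, hd p} \<notin> edges B"
      using A[of "{last p, hd p}"] B[of "{last p, hd p}"] disj by blast+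
    then have "{last p, hd p} = {a, b}" using e by blast
    then show False using crossing[OF 3 disj _ a b] by simp
  next
    case 4
    have "hd p \<in> verts B" "last p \<in> verts A"
      using 4 ends(1)[OF 4(2)] ends(2)[OF 4(4)] ends(3)[OF 4(2)] ends(3)[OF 4(4)] by auto
    then have "{last p, hd p} \<notin> edges A" "{last p, hd p} \<notin> edges B"
      using A[of "{last p, hd p}"] B[of "{last p, hd p}"] disj by blast+
    then have "{last p, hd p} = {b, a}" using e by (simp add: insert_commute)
    then show False using crossing[OF 4 _ _ b a] disj by blast
  qed
qed

text \<open>The nodes of \<open>t\<close> are \<open>N, \<dots>, N + length (labels t) - 1\<close> and \<open>N\<close> is the root.\<close>

fun tree_edges :: "'a link_tree \<Rightarrow> nat \<Rightarrow> nat set set" where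
  "tree_edges (Leaf y) N = {}"
| "tree_edges (Link s W t) N = insert {N, N + length (labels s)}
     (tree_edges s N \<union> tree_edges t (N + length (labels s)))"

fun tree_weight :: "'a link_tree \<Rightarrow> nat \<Rightarrow> nat set \<Rightarrow> ennreal" where
  "tree_weight (Leaf y) N e = \<infinity>"
| "tree_weight (Link s W t) N e =
     (if e = {N, N + length (labels s)} then W
      else if e \<subseteq> {N..<N + length (labels s)} then tree_weight s N e
      else tree_weight t (N + length (labels s)) e)"

definition tree_graph :: "'a link_tree \<Rightarrow> nat \<Rightarrow> nat ugraph" where
  "tree_graph t N = \<lparr>verts = {N..<N + length (labels t)}, edges = tree_edges t N\<rparr>"

lemma tree_graph_simps [simp]:
  "verts (tree_graph t N) = {N..<N + length (labels t)}" "edges (tree_graph t N) = tree_edges t N"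
  by (simp_all add: tree_graph_def)

lemma tree_edges_subset: "e \<in> tree_edges t N \<Longrightarrow> e \<subseteq> {N..<N + length (labels t)} \<and> card e = 2"
proof (induction t arbitrary: N)
  case (Link s W t)
  have "0 < length (labels s)" "0 < length (labels t)" by simp_all
  with Link show ?case by (fastforce simp del: length_greater_0_conv)
qed auto

lemma tree_edges_nonempty: "e \<in> tree_edges t N \<Longrightarrow> e \<noteq> {}"
  using tree_edges_subset by fastforce

lemma finite_tree_edges [simp]: "finite (tree_edges t N)"
  by (induction t arbitrary: N) auto

lemma tree_graph_Link:
  "tree_graph (Link s W t) N = \<lparr>verts = verts (tree_graph s N) \<union> verts (tree_graph t (N + length (labels s))),
     edges = insert {N, N + length (labels s)}
       (edges (tree_graph s N) \<union> edges (tree_graph t (N + length (labels s))))\<rparr>"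
  by (auto simp: tree_graph_def)

lemma graph_tree_graph: "graph (tree_graph t N)"
  using tree_edges_subset by (auto simp: graph_def)

lemma tree_graph_bridge:
  fixes s t :: "'a link_tree" and N :: nat
  defines "A \<equiv> tree_graph s N" and "B \<equiv> tree_graph t (N + length (labels s))"
  shows "\<And>e. e \<in> edges A \<Longrightarrow> e \<subseteq> verts A" "\<And>e. e \<in> edges B \<Longrightarrow> e \<subseteq> verts B"
    "verts A \<inter> verts B = {}" "N \<in> verts A" "N + length (labels s) \<in> verts B"
  using tree_edges_subset unfolding A_def B_def by auto

lemma tree_graph_root_connected:
  "u \<in> verts (tree_graph t N) \<Longrightarrow> same_component (tree_graph t N) N u"
proof (induction t arbitrary: N u)
  case (Leaf y)
  then show ?case by (auto intro: same_component_refl)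
next
  case (Link s W t)
  let ?M = "N + length (labels s)"
  let ?G = "tree_graph (Link s W t) N"
  have mono: "same_component ?G x y"
    if "same_component (tree_graph s N) x y \<or> same_component (tree_graph t ?M) x y" for x y
    using that same_component_mono[of _ x y ?G] by (auto simp: subset_eq)
  have edge: "same_component ?G N ?M" by (rule same_component_edge) auto
  consider "u \<in> verts (tree_graph s N)" | "u \<in> verts (tree_graph t ?M)"
    using Link.prems by fastforce
  then show ?case
  proof cases
    case 1
    then show ?thesis using mono Link.IH(1) by blast
  next
    case 2
    then show ?thesis using edge mono Link.IH(2) same_component_trans by metis
  qed
qed

lemma tree_tree_graph: "tree (tree_graph t N)"
proof -
  have "\<not> cycle (tree_graph t N) p" for p
  proof (induction t arbitrary: N p)
    case (Leaf y)
    show ?case by (auto simp: cycle_def)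
  next
    case (Link s W t)
    show ?case
      by (rule bridge_acyclic[OF tree_graph_bridge tree_graph_Link]) (use Link.IH in auto)
  qed
  moreover have "same_component (tree_graph t N) u v"
    if "u \<in> verts (tree_graph t N)" "v \<in> verts (tree_graph t N)" for u v
    using tree_graph_root_connected that same_component_sym same_component_trans by metis
  ultimately show ?thesis
    using graph_tree_graph unfolding tree_def by (auto simp del: tree_graph_simps(2))
qed

lemma hop_append: "p \<noteq> [] \<Longrightarrow> q \<noteq> [] \<Longrightarrow> hop (p @ q) = Suc (hop p + hop q)"
  by (cases p; cases q) (simp_all add: hop_conv_length)

text \<open>The link is attached at the root of \<open>s\<close>, so a path that starts there and
  enters \<open>t\<close> has to cross it at once. This explains the maximum in
  \<open>depth\<close>.\<close>

lemma hop_path_from_root: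
  "walk (tree_graph t N) p \<Longrightarrow> distinct p \<Longrightarrow> hd p = N \<Longrightarrow> hop p \<le> depth t"
proof (induction t arbitrary: N p)
  case (Leaf y)
  then show ?case by (cases p rule: walk_edges.cases) (auto simp: walk_def)
next
  case (Link s W t)
  let ?A = "tree_graph s N" and ?B = "tree_graph t (N + length (labels s))"
  have B: "hd q \<noteq> N" if "walk ?B q" for q
    using that by (cases q) (auto simp: walk_def)
  consider "walk ?A p" | "walk ?B p"
    | p1 p2 where "p = p1 @ p2" "walk ?A p1" "last p1 = N" "walk ?B p2" "hd p2 = N + length (labels s)"
    | p1 p2 where "p = p1 @ p2" "walk ?B p1"
    using bridge_walk[OF tree_graph_bridge tree_graph_Link Link.prems(1,2)] by blast
  then show ?case
  proof cases
    case 1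
    then show ?thesis using Link by (auto simp: le_max_iff_disj)
  next
    case 2
    then show ?thesis using B[OF 2] Link.prems(3) by simp
  next
    case 3
    have ne: "p1 \<noteq> []" "p2 \<noteq> []" using 3 walk_nonempty by auto
    then have "p1 = [hd p1]" using distinct_hd_eq_last[of p1] Link.prems 3 by auto
    then have "hop p1 = 0" by (metis hop_Cons(2))
    moreover have "hop p2 \<le> depth t" using Link.IH(2) 3 Link.prems by auto
    ultimately show ?thesis using hop_append[OF ne] 3(1) by simp
  next
    case 4
    then have "hd p = hd p1" using walk_nonempty by fastforce
    then show ?thesis using B[OF 4(2)] Link.prems(3) by simp
  qed
qed

text \<open>A path across the link consists of the link and two paths that end in the roots of
  \<open>s\<close> and \<open>t\<close>, and \<open>depth s + 1 + depth t\<close> is at most twice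
  the maximum of \<open>depth s\<close> and \<open>Suc (depth t)\<close>.\<close>

lemma hop_path_tree_graph:
  "walk (tree_graph t N) p \<Longrightarrow> distinct p \<Longrightarrow> hop p \<le> 2 * depth t"
proof (induction t arbitrary: N p)
  case (Leaf y)
  then show ?case by (cases p rule: walk_edges.cases) (auto simp: walk_def)
next
  case (Link s W t)
  let ?A = "tree_graph s N" and ?B = "tree_graph t (N + length (labels s))"
  have cross: "hop (p1 @ p2) \<le> 2 * depth (Link s W t)"
    if "walk C p1" "walk D p2" "distinct p1" "distinct p2"
      "hop p1 \<le> c" "hop p2 \<le> d" "c + d = depth s + depth t" for C D p1 p2 c d
    using that(5-7) hop_append[OF walk_nonempty[OF that(1)] walk_nonempty[OF that(2)]]
    by (auto simp: max_def)
  consider "walk ?A p" | "walk ?B p"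
    | p1 p2 where "p = p1 @ p2" "walk ?A p1" "last p1 = N" "walk ?B p2" "hd p2 = N + length (labels s)"
    | p1 p2 where "p = p1 @ p2" "walk ?B p1" "last p1 = N + length (labels s)" "walk ?A p2" "hd p2 = N"
    using bridge_walk[OF tree_graph_bridge tree_graph_Link Link.prems(1,2)] by blast
  then show ?case
  proof cases
    case 1
    then show ?thesis using Link.IH(1)[OF 1 Link.prems(2)] by (simp add: max_def)
  next
    case 2
    then show ?thesis using Link.IH(2)[OF 2 Link.prems(2)] by (simp add: max_def)
  next
    case 3
    have "hop (rev p1) \<le> depth s" using 3 Link.prems by (intro hop_path_from_root) (auto simp: hd_rev)
    moreover have "hop p2 \<le> depth t" using 3 Link.prems by (intro hop_path_from_root) auto
    ultimately show ?thesis using cross[OF 3(2) 3(4)] 3(1) Link.prems by simp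
  next
    case 4
    have "hop (rev p1) \<le> depth t" using 4 Link.prems by (intro hop_path_from_root) (auto simp: hd_rev)
    moreover have "hop p2 \<le> depth s" using 4 Link.prems by (intro hop_path_from_root) auto
    ultimately show ?thesis using cross[OF 4(2) 4(4)] 4(1) Link.prems by simp
  qed
qed

section \<open>Weights and labels in the numbered tree\<close>

lemma tree_weight_left: "e \<in> tree_edges s N \<Longrightarrow> tree_weight (Link s W t) N e = tree_weight s N e"
  using tree_edges_subset[of e s N] by auto

lemma tree_weight_right:
  assumes "e \<in> tree_edges t (N + length (labels s))"
  shows "tree_weight (Link s W t) N e = tree_weight t (N + length (labels s)) e"
proof -
  have e: "e \<subseteq> {N + length (labels s)..<N + length (labels s) + length (labels t)}" "e \<noteq> {}"
    using tree_edges_subset[OF assms] tree_edges_nonempty[OF assms] by auto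
  have "N \<notin> e" "\<not> e \<subseteq> {N..<N + length (labels s)}" using e by (auto simp: subset_eq) fastforce+
  then show ?thesis by auto
qed

definition node_label :: "'a link_tree \<Rightarrow> nat \<Rightarrow> nat \<Rightarrow> 'a" where
  "node_label t N i = labels t ! (i - N)"

lemma node_label_left:
  "i \<in> verts (tree_graph s N) \<Longrightarrow> node_label (Link s W t) N i = node_label s N i"
  by (auto simp: node_label_def nth_append)

lemma node_label_right:
  "i \<in> verts (tree_graph t (N + length (labels s))) \<Longrightarrow>
    node_label (Link s W t) N i = node_label t (N + length (labels s)) i"
  by (auto simp: node_label_def nth_append)

lemma node_label_root [simp]: "node_label t N N = root t"
  by (simp add: node_label_def root_def hd_conv_nth)

lemma realisable_edge:
  "realisable G w q t \<Longrightarrow> {i, j} \<in> tree_edges t N \<Longrightarrow> 0 < tree_weight t N {i, j} \<and>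
    (tree_weight t N {i, j} < \<infinity> \<longrightarrow>
      reach G w (enn2real (tree_weight t N {i, j})) q (node_label t N i) (node_label t N j))"
proof (induction t arbitrary: N)
  case (Link s W t)
  let ?M = "N + length (labels s)"
  consider "{i, j} = {N, ?M}" | "{i, j} \<in> tree_edges s N" | "{i, j} \<in> tree_edges t ?M"
    using Link.prems(2) by auto
  then show ?case
  proof cases
    case 1
    have "node_label (Link s W t) N ?M = root t"
      using node_label_right[of ?M t N s W] by simp
    then show ?thesis
      using 1 Link.prems(1) reach_sym by (auto simp: doubleton_eq_iff)
  next
    case 2
    have v: "i \<in> verts (tree_graph s N)" "j \<in> verts (tree_graph s N)"
      using tree_edges_subset[OF 2] by auto
    have "realisable G w q s" using Link.prems(1) by simp
    from Link.IH(1)[OF this 2] show ?thesis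
      unfolding tree_weight_left[OF 2] node_label_left[OF v(1)] node_label_left[OF v(2)] .
  next
    case 3
    have v: "i \<in> verts (tree_graph t ?M)" "j \<in> verts (tree_graph t ?M)"
      using tree_edges_subset[OF 3] by auto
    have "realisable G w q t" using Link.prems(1) by simp
    from Link.IH(2)[OF this 3] show ?thesis
      unfolding tree_weight_right[OF 3] node_label_right[OF v(1)] node_label_right[OF v(2)] .
  qed
qed simp

section \<open>From covers to subgraphs\<close>

lemma sum_Un_le:
  fixes f :: "'b \<Rightarrow> ennreal"
  assumes "finite A" "finite B"
  shows "sum f (A \<union> B) \<le> sum f A + sum f B"
proof -
  have "sum f (A \<union> B) \<le> sum f (A \<union> B) + sum f (A \<inter> B)" by simp
  then show ?thesis using sum.union_inter[OF assms, of f] by simp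
qed

text \<open>Since \<open>ennreal\<close> truncates negative reals to 0, budgets may only be added
  there once they are known to be nonnegative.\<close>

lemma rooted_cover_nonneg: "rooted_cover t S c \<Longrightarrow> 0 \<le> c"
proof (induction t arbitrary: S c)
  case (Link s W t)
  show ?case
  proof (cases "rooted_cover s S c")
    case False
    with Link.prems obtain S1 S2 c1 c2 where "rooted_cover s S1 c1" "rooted_cover t S2 c2"
      "c1 + enn2real W + c2 \<le> c" by auto
    moreover from this have "0 \<le> c1" "0 \<le> c2" using Link.IH by blast+
    moreover have "0 \<le> enn2real W" by simp
    ultimately show ?thesis by linarith
  qed (use Link.IH in blast)
qed simp

text \<open>The graph that a \<open>cover\<close> stands for. Any one copy of each element of
  \<open>S\<close> suffices, which is why labels instead of nodes are compared.\<close>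

definition covering_subgraph :: "'a link_tree \<Rightarrow> nat \<Rightarrow> 'a set \<Rightarrow> real \<Rightarrow> nat ugraph \<Rightarrow> bool" where
  "covering_subgraph t N S c H \<longleftrightarrow>
     subgraph H (tree_graph t N) \<and> S \<subseteq> node_label t N ` verts H \<and>
     (\<forall>u\<in>verts H. \<forall>v\<in>verts H. same_component H u v) \<and>
     graph_weight (tree_weight t N) H \<le> ennreal c"

lemma covering_subgraph_left:
  assumes "covering_subgraph s N S c H"
  shows "covering_subgraph (Link s W t) N S c H"
proof -
  have sub: "verts H \<subseteq> verts (tree_graph s N)" "edges H \<subseteq> tree_edges s N"
    using assms by (auto simp: covering_subgraph_def subgraph_def)
  have "graph_weight (tree_weight (Link s W t) N) H = graph_weight (tree_weight s N) H"
    unfolding graph_weight_def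
    by (rule sum.cong[OF refl]) (use sub tree_weight_left in blast)
  moreover have "node_label (Link s W t) N ` verts H = node_label s N ` verts H"
    by (rule image_cong[OF refl]) (use sub node_label_left in blast)
  ultimately show ?thesis
    using assms by (auto simp: covering_subgraph_def subgraph_def)
qed

lemma covering_subgraph_right:
  assumes "covering_subgraph t (N + length (labels s)) S c H"
  shows "covering_subgraph (Link s W t) N S c H"
proof -
  let ?M = "N + length (labels s)"
  have sub: "verts H \<subseteq> verts (tree_graph t ?M)" "edges H \<subseteq> tree_edges t ?M"
    using assms by (auto simp: covering_subgraph_def subgraph_def)
  have "graph_weight (tree_weight (Link s W t) N) H = graph_weight (tree_weight t ?M) H"
    unfolding graph_weight_def
    by (rule sum.cong[OF refl]) (use sub tree_weight_right in blast)
  moreover have "node_label (Link s W t) N ` verts H = node_label t ?M ` verts H"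
    by (rule image_cong[OF refl]) (use sub node_label_right in blast)
  moreover have "subgraph H (tree_graph (Link s W t) N)"
    using assms by (auto simp: covering_subgraph_def subgraph_def)
  ultimately show ?thesis
    using assms by (auto simp: covering_subgraph_def)
qed

lemma covering_subgraph_Link:
  assumes H1: "covering_subgraph s N S1 c1 H1" "N \<in> verts H1"
    and H2: "covering_subgraph t (N + length (labels s)) S2 c2 H2" "N + length (labels s) \<in> verts H2"
    and "W < \<infinity>" "0 \<le> c1" "0 \<le> c2" and c: "c1 + enn2real W + c2 \<le> c" and S: "S \<subseteq> S1 \<union> S2"
  shows "covering_subgraph (Link s W t) N S c \<lparr>verts = verts H1 \<union> verts H2,
    edges = insert {N, N + length (labels s)} (edges H1 \<union> edges H2)\<rparr>"
proof -
  let ?M = "N + length (labels s)" and ?w = "tree_weight (Link s W t) N"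
  let ?H = "\<lparr>verts = verts H1 \<union> verts H2, edges = insert {N, ?M} (edges H1 \<union> edges H2)\<rparr>"
  have L1: "covering_subgraph (Link s W t) N S1 c1 H1" using H1(1) by (rule covering_subgraph_left)
  have L2: "covering_subgraph (Link s W t) N S2 c2 H2" using H2(1) by (rule covering_subgraph_right)
  have fin: "finite (edges H1)" "finite (edges H2)"
    using L1 L2 finite_tree_edges by (auto simp: covering_subgraph_def subgraph_def intro: finite_subset)
  have "subgraph ?H (tree_graph (Link s W t) N)"
    using L1 L2 H1(2) H2(2) by (auto simp: covering_subgraph_def subgraph_def graph_def)
  moreover have "S \<subseteq> node_label (Link s W t) N ` verts ?H"
    using L1 L2 S by (auto simp: covering_subgraph_def image_Un)
  moreover have "same_component ?H u v" if "u \<in> verts ?H" "v \<in> verts ?H" for u v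
  proof -
    have edge: "same_component ?H N ?M" using H1(2) H2(2) by (intro same_component_edge) auto
    have root: "same_component ?H N x" if "x \<in> verts ?H" for x
    proof (cases "x \<in> verts H1")
      case True
      then have "same_component H1 N x" using H1 by (auto simp: covering_subgraph_def)
      then show ?thesis by (rule same_component_mono) auto
    next
      case False
      then have "same_component H2 ?M x" using H2 that by (auto simp: covering_subgraph_def)
      then have "same_component ?H ?M x" by (rule same_component_mono) auto
      with edge show ?thesis by (rule same_component_trans)
    qed
    show ?thesis
      by (rule same_component_trans[OF same_component_sym[OF root[OF that(1)]] root[OF that(2)]])
  qed
  moreover have "graph_weight ?w ?H \<le> ennreal c"
  proof -
    have "graph_weight ?w ?H \<le> W + (graph_weight ?w H1 + graph_weight ?w H2)"
    proof -
      have "sum ?w (insert {N, ?M} (edges H1 \<union> edges H2)) \<le> W + sum ?w (edges H1 \<union> edges H2)"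
        using sum_Un_le[of "{{N, ?M}}" "edges H1 \<union> edges H2" ?w] fin by simp
      also have "\<dots> \<le> W + (sum ?w (edges H1) + sum ?w (edges H2))"
        using sum_Un_le[OF fin] by (intro add_left_mono)
      finally show ?thesis by (simp only: graph_weight_def ugraph.simps)
    qed
    also have "\<dots> \<le> ennreal (enn2real W) + (ennreal c1 + ennreal c2)"
      using L1 L2 \<open>W < \<infinity>\<close> by (intro add_mono) (auto simp: covering_subgraph_def)
    also have "\<dots> = ennreal (c1 + enn2real W + c2)"
      using assms by (simp add: add_ac)
    also have "\<dots> \<le> ennreal c" using c by (rule ennreal_leI)
    finally show ?thesis .
  qed
  ultimately show ?thesis unfolding covering_subgraph_def by blast
qed

lemma rooted_cover_subgraph:
  "rooted_cover t S c \<Longrightarrow> \<exists>H. covering_subgraph t N S c H \<and> N \<in> verts H"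
proof (induction t arbitrary: N S c)
  case (Leaf y)
  let ?H = "\<lparr>verts = {N}, edges = {}\<rparr> :: nat ugraph"
  have "same_component ?H N N" by (rule same_component_refl) simp
  then have "covering_subgraph (Leaf y) N S c ?H"
    using Leaf by (auto simp: covering_subgraph_def subgraph_def graph_def graph_weight_def)
  then show ?case by (intro exI[of _ ?H]) simp
next
  case (Link s W t)
  show ?case
  proof (cases "rooted_cover s S c")
    case True
    then show ?thesis using Link.IH(1) covering_subgraph_left by metis
  next
    case False
    with Link.prems obtain S1 S2 c1 c2 where *: "W < \<infinity>" "rooted_cover s S1 c1"
      "rooted_cover t S2 c2" "S \<subseteq> S1 \<union> S2" "c1 + enn2real W + c2 \<le> c" by auto
    obtain H1 where H1: "covering_subgraph s N S1 c1 H1" "N \<in> verts H1"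
      using Link.IH(1)[OF *(2)] by blast
    obtain H2 where H2: "covering_subgraph t (N + length (labels s)) S2 c2 H2"
      "N + length (labels s) \<in> verts H2"
      using Link.IH(2)[OF *(3)] by blast
    show ?thesis
      by (rule exI, rule conjI, rule covering_subgraph_Link[OF H1 H2 *(1) rooted_cover_nonneg[OF *(2)]
            rooted_cover_nonneg[OF *(3)] *(5,4)]) (use H1(2) in simp)
  qed
qed

lemma cover_subgraph: "cover t S c \<Longrightarrow> \<exists>H. covering_subgraph t N S c H"
proof (induction t arbitrary: N S c)
  case (Leaf y)
  then show ?case using rooted_cover_subgraph[of "Leaf y" S c N] by auto
next
  case (Link s W t)
  then consider "rooted_cover (Link s W t) S c" | "cover s S c" | "cover t S c"
    unfolding cover.simps by blast
  then show ?case
  proof cases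
    case 1
    then show ?thesis using rooted_cover_subgraph by blast
  next
    case 2
    then show ?thesis using Link.IH(1) covering_subgraph_left by blast
  next
    case 3
    then show ?thesis using Link.IH(2) covering_subgraph_right by blast
  qed
qed

text \<open>Different tours are merged by uniting edges. All nodes are kept, at no cost in weight,
  so that a vertex which is on no tour is still connected to itself.\<close>

lemma covers_subgraph:
  "(\<And>\<sigma>. \<sigma> \<in> set \<Sigma> \<Longrightarrow> cover t (set \<sigma>) (c \<sigma>) \<and> 0 \<le> c \<sigma>) \<Longrightarrow>
    \<exists>H. subgraph H (tree_graph t N) \<and> verts H = verts (tree_graph t N) \<and>
      (\<forall>\<sigma>\<in>set \<Sigma>. \<forall>u\<in>set \<sigma>. \<forall>v\<in>set \<sigma>. \<exists>u'\<in>verts H. \<exists>v'\<in>verts H.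
        node_label t N u' = u \<and> node_label t N v' = v \<and> same_component H u' v') \<and>
      graph_weight (tree_weight t N) H \<le> ennreal (\<Sum>\<sigma>\<leftarrow>\<Sigma>. c \<sigma>)"
proof (induction \<Sigma>)
  case Nil
  show ?case
    by (intro exI[of _ "\<lparr>verts = verts (tree_graph t N), edges = {}\<rparr>"])
      (auto simp: subgraph_def graph_def graph_weight_def)
next
  case (Cons \<sigma> \<Sigma>)
  obtain H where H: "subgraph H (tree_graph t N)" "verts H = verts (tree_graph t N)"
    "\<forall>\<sigma>\<in>set \<Sigma>. \<forall>u\<in>set \<sigma>. \<forall>v\<in>set \<sigma>. \<exists>u'\<in>verts H. \<exists>v'\<in>verts H.
        node_label t N u' = u \<and> node_label t N v' = v \<and> same_component H u' v'"
    "graph_weight (tree_weight t N) H \<le> ennreal (\<Sum>\<sigma>\<leftarrow>\<Sigma>. c \<sigma>)"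
    using Cons by (metis list.set_intros(2))
  obtain K where K: "covering_subgraph t N (set \<sigma>) (c \<sigma>) K"
    using Cons.prems[of \<sigma>] cover_subgraph by force
  then have Ksub: "subgraph K (tree_graph t N)" by (simp add: covering_subgraph_def)
  let ?U = "\<lparr>verts = verts H, edges = edges K \<union> edges H\<rparr>"
  have fin: "finite (edges K)" "finite (edges H)"
    using Ksub H(1) finite_tree_edges by (auto simp: subgraph_def intro: finite_subset)
  have KH: "verts K \<subseteq> verts H" using Ksub H(2) unfolding subgraph_def by simp
  have sub: "subgraph ?U (tree_graph t N)"
  proof -
    have "edges ?U \<subseteq> tree_edges t N" using Ksub H(1) by (simp add: subgraph_def)
    then show ?thesis
      using tree_edges_subset[of _ t N] H(2) unfolding subgraph_def graph_def by (simp; blast)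
  qed
  have "\<exists>u'\<in>verts ?U. \<exists>v'\<in>verts ?U.
      node_label t N u' = u \<and> node_label t N v' = v \<and> same_component ?U u' v'"
    if "\<tau> \<in> set (\<sigma> # \<Sigma>)" "u \<in> set \<tau>" "v \<in> set \<tau>" for \<tau> u v
  proof (cases "\<tau> = \<sigma>")
    case True
    have "u \<in> node_label t N ` verts K" "v \<in> node_label t N ` verts K"
      using K that True by (auto simp: covering_subgraph_def)
    then obtain u' v' where uv: "u' \<in> verts K" "v' \<in> verts K" "node_label t N u' = u" "node_label t N v' = v"
      by auto
    then have "same_component K u' v'" using K by (simp add: covering_subgraph_def)
    then have "same_component ?U u' v'" by (rule same_component_mono) (use KH in auto)
    then show ?thesis using uv KH by auto
  next
    case False
    then have "\<tau> \<in> set \<Sigma>" using that(1) by simp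
    from H(3)[rule_format, OF this that(2,3)]
    obtain u' v' where uv: "u' \<in> verts H" "v' \<in> verts H" "node_label t N u' = u"
      "node_label t N v' = v" "same_component H u' v'" by blast
    have "same_component ?U u' v'" using uv(5) by (rule same_component_mono) auto
    then show ?thesis using uv by auto
  qed
  moreover have "graph_weight (tree_weight t N) ?U \<le> ennreal (\<Sum>\<tau>\<leftarrow>\<sigma> # \<Sigma>. c \<tau>)"
  proof -
    have "graph_weight (tree_weight t N) ?U \<le>
        graph_weight (tree_weight t N) K + graph_weight (tree_weight t N) H"
      using sum_Un_le[OF fin] by (simp add: graph_weight_def)
    also have "\<dots> \<le> ennreal (c \<sigma>) + ennreal (\<Sum>\<tau>\<leftarrow>\<Sigma>. c \<tau>)"
      using K H(4) by (intro add_mono) (auto simp: covering_subgraph_def)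
    also have "\<dots> = ennreal (\<Sum>\<tau>\<leftarrow>\<sigma> # \<Sigma>. c \<tau>)"
      using Cons.prems by (subst ennreal_plus[symmetric]) (auto intro!: sum_list_nonneg)
    finally show ?thesis .
  qed
  ultimately show ?case using sub H(2) by (intro exI[of _ ?U]) auto
qed

section \<open>The embedding given by a realisable link tree\<close>

definition copies :: "'a link_tree \<Rightarrow> 'a \<Rightarrow> nat set" where
  "copies t v = {i \<in> verts (tree_graph t 0). node_label t 0 i = v}"

lemma ennreal_len:
  assumes "weighted_graph G w" "walk G p"
  shows "walk_weight w p = ennreal (len w p)"
proof -
  have "\<forall>e\<in>set es. w e < \<infinity> \<Longrightarrow> (\<Sum>e\<leftarrow>es. w e) = ennreal (\<Sum>e\<leftarrow>es. enn2real (w e))" for es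
  proof (induction es)
    case (Cons e es)
    have "0 \<le> (\<Sum>e\<leftarrow>es. enn2real (w e))" by (intro sum_list_nonneg) auto
    then show ?case using Cons by simp
  qed simp
  moreover have "\<forall>e\<in>set (walk_edges p). w e < \<infinity>"
    using assms by (auto simp: weighted_graph_def walk_def)
  ultimately show ?thesis by (simp add: walk_weight_def len_def)
qed

lemma reach_imp_path:
  assumes "weighted_graph G w" "reach G w a q u v"
  shows "\<exists>p. path G u p v \<and> walk_weight w p \<le> ennreal a \<and> hop p \<le> q"
proof -
  obtain p where p: "walk G p" "hd p = u" "last p = v" "len w p \<le> a" "hop p \<le> q"
    using assms(2) by (auto simp: reach_def)
  obtain p' where p': "path G u p' v" "mset (walk_edges p') \<subseteq># mset (walk_edges p)"
    using walk_imp_path[OF p(1)] p by auto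
  have "len w p' \<le> len w p" unfolding len_def by (rule mset_subset_sum_list_le[OF p'(2)]) simp
  moreover have "hop p' \<le> hop p"
    using size_mset_mono[OF p'(2)] by (simp add: hop_def)
  moreover have "walk_weight w p' = ennreal (len w p')"
    using ennreal_len[OF assms(1)] p'(1) by (simp add: path_def)
  ultimately show ?thesis using p p'(1) by (intro exI[of _ p']) (auto intro: ennreal_leI)
qed

text \<open>Replacing the links of a finite tree path by their walks in \<open>G\<close> never
  increases the weight, which yields domination. Such a tree path has at most
  \<open>2 * depth T\<close> links, with at most \<open>Q\<close> hops each.\<close>

lemma link_tree_embedding:
  assumes G: "weighted_graph G w" and real: "realisable G w Q T" and lab: "set (labels T) = verts G"
  shows "\<exists>P. path_tree_embedding G w (tree_graph T 0) (tree_weight T 0) (copies T) P \<and>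
    has_hop_bound G (tree_graph T 0) (tree_weight T 0) (copies T) P (real (2 * depth T * Q))"
proof -
  let ?T = "tree_graph T 0" and ?w = "tree_weight T 0" and ?l = "node_label T 0"
  define R where "R i j = (SOME p. path G (?l i) p (?l j) \<and> walk_weight w p \<le> ?w {i, j} \<and> hop p \<le> Q)"
    for i j
  \<comment> \<open>The two orientations of an edge have to be reversals of each other, so a path is
    chosen for \<open>i < j\<close> only.\<close>
  define P where "P i j = (if i < j then R i j else rev (R j i))" for i j
  have l_verts: "?l i \<in> verts G" if "i \<in> verts ?T" for i
    using that nth_mem[of i "labels T"] by (simp add: node_label_def lab)
  have R: "path G (?l i) (R i j) (?l j)" "walk_weight w (R i j) \<le> ?w {i, j}" "hop (R i j) \<le> Q"
    if "{i, j} \<in> edges ?T" "?w {i, j} < \<infinity>" for i j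
  proof -
    have "reach G w (enn2real (?w {i, j})) Q (?l i) (?l j)"
      using realisable_edge[OF real, of i j 0] that by auto
    from reach_imp_path[OF G this] that(2)
    have "\<exists>p. path G (?l i) p (?l j) \<and> walk_weight w p \<le> ?w {i, j} \<and> hop p \<le> Q" by simp
    from someI_ex[OF this] show "path G (?l i) (R i j) (?l j)" "walk_weight w (R i j) \<le> ?w {i, j}"
      "hop (R i j) \<le> Q" unfolding R_def by blast+
  qed
  have weight_rev: "walk_weight w (rev p) = walk_weight w p" for p
    by (simp add: walk_weight_def walk_edges_rev rev_map[symmetric] sum_list_rev)
  have P: "path G (?l i) (P i j) (?l j)" "walk_weight w (P i j) \<le> ?w {i, j}" "hop (P i j) \<le> Q"
    "P j i = rev (P i j)" if "{i, j} \<in> edges ?T" "?w {i, j} < \<infinity>" for i j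
  proof -
    have "card {i, j} = 2" using tree_edges_subset[of "{i, j}" T 0] that by simp
    then have "i \<noteq> j" by auto
    have ji: "{j, i} = {i, j}" by blast
    show "path G (?l i) (P i j) (?l j)" "walk_weight w (P i j) \<le> ?w {i, j}" "hop (P i j) \<le> Q"
      "P j i = rev (P i j)"
      using R[of i j] R[of j i] that \<open>i \<noteq> j\<close> unfolding P_def ji by (auto intro: path_rev simp: weight_rev)
  qed
  have original: "original G (copies T) i = ?l i" if "i \<in> verts ?T" for i
    unfolding original_def using that l_verts by (intro the_equality) (auto simp: copies_def)
  have induced: "walk G (induced_walk G (copies T) P q) \<and>
      hd (induced_walk G (copies T) P q) = ?l (hd q) \<and> last (induced_walk G (copies T) P q) = ?l (last q) \<and>
      walk_weight w (induced_walk G (copies T) P q) \<le> walk_weight ?w q \<and>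
      hop (induced_walk G (copies T) P q) \<le> hop q * Q"
    if "walk ?T q" "\<forall>e\<in>set (walk_edges q). ?w e < \<infinity>" for q
    using that
  proof (induction q rule: walk_edges.induct)
    case (1 i j q)
    let ?p = "induced_walk G (copies T) P (j # q)"
    have IH: "walk G ?p" "hd ?p = ?l j" "last ?p = ?l (last (j # q))"
      "walk_weight w ?p \<le> walk_weight ?w (j # q)" "hop ?p \<le> hop (j # q) * Q"
      using 1 by (auto simp: walk_Cons)
    have ij: "{i, j} \<in> edges ?T" "?w {i, j} < \<infinity>" using "1.prems" by (auto simp: walk_Cons)
    have Pij: "walk G (P i j)" "hd (P i j) = ?l i" "last (P i j) = ?l j"
      using P(1)[OF ij] by (auto simp: path_def)
    note ne = walk_nonempty[OF Pij(1)] walk_nonempty[OF IH(1)]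
    note join = walk_join_props[OF ne]
    have eq: "last (P i j) = hd ?p" using Pij IH by simp
    have "walk_weight w (walk_join (P i j) ?p) = walk_weight w (P i j) + walk_weight w ?p"
      using join(1)[OF eq] by (simp add: walk_weight_def)
    also have "\<dots> \<le> ?w {i, j} + walk_weight ?w (j # q)" using IH P(2)[OF ij] by (intro add_mono)
    finally have "walk_weight w (walk_join (P i j) ?p) \<le> walk_weight ?w (i # j # q)"
      by (simp add: walk_weight_def)
    moreover have "hop (walk_join (P i j) ?p) \<le> hop (i # j # q) * Q"
      using join(5)[OF eq] IH(5) P(3)[OF ij] by simp
    ultimately show ?case
      using join(2-4)[OF eq] Pij IH by simp
  next
    case ("2_2" i)
    then show ?case using original l_verts by (simp add: walk_weight_def)
  qed (simp add: walk_def)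
  have "dist_graph G w u v \<le> dist_graph ?T ?w u' v'"
    if "u' \<in> copies T u" "v' \<in> copies T v" for u v u' v'
    unfolding dist_graph_def[of ?T]
  proof (rule Inf_greatest)
    fix x assume "x \<in> {walk_weight ?w q |q. path ?T u' q v'}"
    then obtain q where x: "x = walk_weight ?w q" and q: "walk ?T q" "hd q = u'" "last q = v'"
      by (auto simp: path_def)
    show "dist_graph G w u v \<le> x"
    proof (cases "\<forall>e\<in>set (walk_edges q). ?w e < \<infinity>")
      case True
      let ?p = "induced_walk G (copies T) P q"
      have p: "walk G ?p" "hd ?p = u" "last ?p = v" "walk_weight w ?p \<le> x"
        using induced[OF q(1) True] q(2,3) that x by (auto simp: copies_def)
      obtain p where "path G u p v" "mset (walk_edges p) \<subseteq># mset (walk_edges ?p)"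
        using walk_imp_path[OF p(1)] p by auto
      then have "dist_graph G w u v \<le> walk_weight w p" "walk_weight w p \<le> walk_weight w ?p"
        unfolding dist_graph_def walk_weight_def
        by (auto intro!: Inf_lower mset_subset_sum_list_le)
      then show ?thesis using p(4) by order
    next
      case False
      then obtain e where "e \<in> set (walk_edges q)" "?w e = \<infinity>" by (metis infinity_ennreal_def less_top)
      then have "x = \<infinity>"
        unfolding x walk_weight_def by (auto dest!: split_list)
      then show ?thesis by simp
    qed
  qed
  then have "dominating G w ?T ?w (copies T)" unfolding dominating_def by blast
  moreover have "one_to_many G ?T (copies T)"
  proof -
    have "copies T v \<noteq> {}" if v: "v \<in> verts G" for v
    proof -
      obtain i where "i < length (labels T)" "labels T ! i = v" using v lab by (metis in_set_conv_nth)
      then have "i \<in> copies T v" by (simp add: copies_def node_label_def)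
      then show ?thesis by blast
    qed
    then show ?thesis by (auto simp: one_to_many_def copies_def)
  qed
  moreover have "(\<Union>v\<in>verts G. copies T v) = verts ?T"
    using l_verts by (auto simp: copies_def)
  moreover have "\<forall>e\<in>edges ?T. 0 < ?w e"
  proof
    fix e assume e: "e \<in> edges ?T"
    then obtain i j where "e = {i, j}" using tree_edges_subset[of e T 0] by (auto simp: card_2_iff)
    then show "0 < ?w e" using realisable_edge[OF real, of i j 0] e by simp
  qed
  ultimately have "path_tree_embedding G w ?T ?w (copies T) P"
    using tree_tree_graph P unfolding path_tree_embedding_def by (auto simp: copies_def)
  moreover have "has_hop_bound G ?T ?w (copies T) P (real (2 * depth T * Q))"
    unfolding has_hop_bound_def
  proof (intro ballI allI impI)
    fix u' v' q assume q: "path ?T u' q v' \<and> (\<forall>e\<in>set (walk_edges q). ?w e < \<infinity>)"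
    then have "hop (induced_walk G (copies T) P q) \<le> hop q * Q" using induced by (auto simp: path_def)
    also have "\<dots> \<le> 2 * depth T * Q"
      using hop_path_tree_graph[of T 0 q] q by (intro mult_right_mono) (auto simp: path_def)
    finally show "real (hop (induced_walk G (copies T) P q)) \<le> real (2 * depth T * Q)" by linarith
  qed
  ultimately show ?thesis by blast
qed

section \<open>Hop distances, edge counts and the aspect ratio\<close>

lemma hop_dist_le_imp_path:
  assumes "hop_dist H u v \<le> enat h"
  shows "\<exists>p. path H u p v \<and> hop p \<le> h"
proof -
  let ?A = "{enat (hop p) |p. path H u p v}"
  have "?A \<noteq> {}"
  proof
    assume "?A = {}"
    then show False using assms unfolding hop_dist_def by (simp add: Inf_enat_def)
  qed
  then have "Inf ?A \<in> ?A" unfolding Inf_enat_def by (metis (mono_tags, lifting) LeastI ex_in_conv)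
  then show ?thesis using assms unfolding hop_dist_def by auto
qed

lemma graph_weight_eq_wsum:
  assumes "weighted_graph G w" "edges H \<subseteq> edges G"
  shows "graph_weight w H = ennreal (wsum w (edges H))"
proof -
  have "graph_weight w H = (\<Sum>e\<in>edges H. ennreal (enn2real (w e)))"
    unfolding graph_weight_def using assms
    by (intro sum.cong) (auto simp: weighted_graph_def)
  then show ?thesis by (simp add: wsum_def sum_ennreal)
qed

lemma card_edges_le:
  assumes "graph G"
  shows "finite (edges G)" and "2 * card (edges G) \<le> card (verts G) ^ 2"
proof -
  let ?E = "{e. e \<subseteq> verts G \<and> card e = 2}"
  have fin: "finite (verts G)" and sub: "edges G \<subseteq> ?E" using assms by (auto simp: graph_def)
  have finE: "finite ?E" using fin by simp
  show "finite (edges G)" using sub finE by (rule finite_subset)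
  have "card (edges G) \<le> card (verts G) choose 2"
    using card_mono[OF finE sub] n_subsets[OF fin, of 2] by simp
  then have "2 * card (edges G) \<le> 2 * (card (verts G) * (card (verts G) - 1) div 2)"
    by (simp add: choose_two)
  also have "\<dots> \<le> card (verts G) * (card (verts G) - 1)" by simp
  also have "\<dots> \<le> card (verts G) ^ 2" by (simp add: power2_eq_square)
  finally show "2 * card (edges G) \<le> card (verts G) ^ 2" .
qed

text \<open>With \<open>\<rho>\<close> the least weight, there are at most half of the squared
  number of vertices many edges, and each is at most the aspect ratio times \<open>\<rho>\<close>.
  The factor 2 on the left leaves room for tours, whose length may be twice the weight of a
  subgraph. The absolute value admits negative \<open>c\<close>.\<close>

lemma aspect_ratio_weights:
  assumes G: "weighted_graph G w" and "verts G \<noteq> {}"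
    and aspect: "aspect_ratio G w \<le> ennreal (real (card (verts G)) powr c)"
    and L: "real (card (verts G)) powr (2 + \<bar>c\<bar>) < 2 ^ L"
  shows "\<exists>\<rho>>0. (\<forall>e\<in>edges G. \<rho> \<le> enn2real (w e)) \<and> 2 * wsum w (edges G) < 2 ^ L * \<rho>"
proof (cases "edges G = {}")
  case True
  then show ?thesis by (intro exI[of _ 1]) (simp add: wsum_def)
next
  case False
  let ?E = "edges G" and ?r = "\<lambda>e. enn2real (w e)" and ?n = "real (card (verts G))"
  have gr: "graph G" and w: "\<And>e. e \<in> ?E \<Longrightarrow> 0 < w e \<and> w e < \<infinity>"
    using G by (auto simp: weighted_graph_def)
  note fin = card_edges_le(1)[OF gr]
  have n: "1 \<le> ?n" using gr \<open>verts G \<noteq> {}\<close> by (auto simp: graph_def card_gt_0_iff Suc_le_eq)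
  have "Min (w ` ?E) \<in> w ` ?E" "Max (w ` ?E) \<in> w ` ?E" using fin False by auto
  then obtain a b where ab: "a \<in> ?E" "Min (w ` ?E) = w a" "b \<in> ?E" "Max (w ` ?E) = w b" by auto
  have pos: "0 < ?r e" "w e = ennreal (?r e)" if "e \<in> ?E" for e
    using w[OF that] by (auto simp: enn2real_positive_iff)
  have lower: "?r a \<le> ?r e" if "e \<in> ?E" for e
  proof -
    have "w a \<le> w e" using Min_le[of "w ` ?E" "w e"] fin that ab by simp
    then show ?thesis using w that by (intro enn2real_mono) auto
  qed
  have upper: "?r e \<le> ?r b" if "e \<in> ?E" for e
  proof -
    have "w e \<le> w b" using Max_ge[of "w ` ?E" "w e"] fin that ab by simp
    then show ?thesis using w ab(3) by (intro enn2real_mono) auto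
  qed
  have "ennreal (?r b) / ennreal (?r a) \<le> ennreal (?n powr c)"
    using aspect False pos(2)[OF ab(1)] pos(2)[OF ab(3)] by (simp add: aspect_ratio_def ab)
  then have "?r b / ?r a \<le> ?n powr c"
    using pos(1)[OF ab(1)] by (simp add: divide_ennreal)
  then have b: "?r b \<le> ?n powr c * ?r a" using pos(1)[OF ab(1)] by (simp add: field_simps)
  have "2 * wsum w ?E \<le> 2 * (real (card ?E) * ?r b)"
    unfolding wsum_def using upper by (intro mult_left_mono sum_bounded_above) auto
  also have "\<dots> = real (2 * card ?E) * ?r b" by simp
  also have "\<dots> \<le> real (card (verts G) ^ 2) * ?r b"
    using card_edges_le(2)[OF gr] by (intro mult_right_mono of_nat_mono) auto
  also have "\<dots> \<le> ?n ^ 2 * (?n powr c * ?r a)" using b by (simp add: mult_left_mono)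
  also have "\<dots> = ?n powr (2 + c) * ?r a" using n by (simp add: powr_add powr_numeral)
  also have "\<dots> \<le> ?n powr (2 + \<bar>c\<bar>) * ?r a" using n by (intro mult_right_mono powr_mono) auto
  also have "\<dots> < 2 ^ L * ?r a" using L pos(1)[OF ab(1)] by simp
  finally show ?thesis using pos(1)[OF ab(1)] lower by blast
qed

section \<open>Choice of the parameters\<close>

theorem theorem11:
  fixes c :: real
  shows "\<exists>C1>0. \<exists>C2>0.
    \<forall>(G :: 'a ugraph) (w :: 'a set \<Rightarrow> ennreal) (n :: nat) (h :: nat) (k :: nat) (r :: 'a).
      weighted_graph G w \<and> n = card (verts G) \<and> aspect_ratio G w \<le> ennreal (real n powr c) \<and>
      h \<ge> 1 \<and> k \<ge> 1 \<and> r \<in> verts G \<longrightarrow>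
      (\<exists>(T :: nat ugraph) (wT :: nat set \<Rightarrow> ennreal) (f :: 'a \<Rightarrow> nat set)
         (P :: nat \<Rightarrow> nat \<Rightarrow> 'a list).
        path_tree_embedding G w T wT f P \<and>
        has_hop_bound G T wT f P
          (C1 * real k * (lg (real n))^2 * lg (lg (real n)) * real h) \<and>
        real (card (\<Union>v\<in>verts G. f v)) \<le> (2 * real n) powr (1 + 1 / real k) \<and>
        card (f r) = 1 \<and>
        (\<forall>H. subgraph H G \<longrightarrow>
          (\<exists>H'. subgraph H' T \<and>
            (\<forall>u\<in>verts H. \<forall>v\<in>verts H. hop_dist H u v \<le> enat h \<longrightarrow>
              (\<exists>u'\<in>f u \<inter> verts H'. \<exists>v'\<in>f v \<inter> verts H'. same_component H' u' v')) \<and>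
            graph_weight wT H' \<le>
              ennreal (C2 * real k * lg (real n) * lg (lg (real n))) * graph_weight w H)))"
proof -
  \<comment> \<open>Rounding gives \<open>L \<le> (2 + \<bar>c\<bar>) * lg n + 2\<close>, and since
    \<open>lg n\<close> is at least 1, also \<open>L + 1 \<le> a * lg n\<close>.\<close>
  define a where "a = 5 + \<bar>c\<bar>"
  have a: "5 \<le> a" by (simp add: a_def)
  show ?thesis
  \<comment> \<open>The hop bound \<open>2 * depth T * (J * q)\<close> with
    \<open>q = 2 * (L * h)\<close> yields 4, the weight bound \<open>8 * J * L\<close> times the
    factor 4 of the tours yields 32; \<open>J \<le> 6 * (k * lg (lg n))\<close> multiplies both by
    6.\<close>
  proof (rule exI[of _ "24 * a\<^sup>2"], intro exI[of _ "192 * a"] conjI allI impI)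
    show "0 < 24 * a\<^sup>2" "0 < 192 * a" using a by auto
    fix G :: "'a ugraph" and w :: "'a set \<Rightarrow> ennreal" and n h k :: nat and r :: 'a
    assume asm: "weighted_graph G w \<and> n = card (verts G) \<and> aspect_ratio G w \<le> ennreal (real n powr c) \<and>
      h \<ge> 1 \<and> k \<ge> 1 \<and> r \<in> verts G"
    then have G: "weighted_graph G w" and n: "n = card (verts G)" and k: "1 \<le> k" and r: "r \<in> verts G"
      and aspect: "aspect_ratio G w \<le> ennreal (real (card (verts G)) powr c)" by auto
    have gr: "graph G" and fin: "finite (verts G)" using G by (auto simp: weighted_graph_def graph_def)
    have n1: "1 \<le> n" using fin r by (auto simp: n card_gt_0_iff Suc_le_eq)
    let ?l = "lg (real n)" and ?ll = "lg (lg (real n))"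
    have lg: "1 \<le> ?l" "log 2 (real n) \<le> ?l" "1 \<le> ?ll" "log 2 ?l \<le> ?ll" by (auto simp: lg_def)
    define m where "m = nat \<lceil>?ll\<rceil>"
    have m: "?ll \<le> real m" "real m \<le> 2 * ?ll" using lg by (auto simp: m_def) linarith+
    define J where "J = 2 * (k * m + 1)"
    \<comment> \<open>The added 1 makes the bound on \<open>n powr (2 + \<bar>c\<bar>)\<close>
      strict, as needed for tours to stay strictly below the top scale.\<close>
    define L where "L = nat \<lceil>(2 + \<bar>c\<bar>) * ?l\<rceil> + 1"
    have "0 \<le> (2 + \<bar>c\<bar>) * ?l" using lg by simp
    then have L: "(2 + \<bar>c\<bar>) * ?l + 1 \<le> real L" "real L \<le> (2 + \<bar>c\<bar>) * ?l + 2"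
      by (auto simp: L_def) linarith+
    have La: "real L + 1 \<le> a * ?l" using L(2) lg(1) by (simp add: a_def algebra_simps)
    have kll: "1 \<le> real k * ?ll" using k lg(3) by (intro mult_ge1_I) auto
    have "real k * real m \<le> real k * (2 * ?ll)" using m by (intro mult_left_mono) auto
    \<comment> \<open>The summand 1 in \<open>k * m + 1\<close> is absorbed because
      \<open>k * lg (lg n)\<close> is at least 1.\<close>
    then have J6: "real J \<le> 6 * (real k * ?ll)" using kll by (simp add: J_def)
    have pm: "log 2 (real (card (verts G))) \<le> 2 ^ m"
    proof -
      have "?l = 2 powr (log 2 ?l)" using lg(1) by simp
      also have "\<dots> \<le> 2 powr real m" using lg m by (intro powr_mono) auto
      finally show ?thesis using lg(2) by (simp add: n powr_realpow)
    qed
    have pL: "real (card (verts G)) powr (2 + \<bar>c\<bar>) < 2 ^ L"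
    proof -
      have "real n powr (2 + \<bar>c\<bar>) = 2 powr (log 2 (real n) * (2 + \<bar>c\<bar>))"
        using n1 by (simp flip: powr_powr)
      also have "\<dots> < 2 powr real L"
      proof (intro powr_less_mono)
        have "log 2 (real n) * (2 + \<bar>c\<bar>) \<le> ?l * (2 + \<bar>c\<bar>)" using lg by (intro mult_right_mono) auto
        then show "log 2 (real n) * (2 + \<bar>c\<bar>) < real L" using L(1) by (simp add: mult.commute)
      qed auto
      finally show ?thesis by (simp add: n powr_realpow)
    qed
    obtain \<rho> where \<rho>: "0 < \<rho>" "\<And>e. e \<in> edges G \<Longrightarrow> \<rho> \<le> enn2real (w e)"
      "2 * wsum w (edges G) < 2 ^ L * \<rho>"
      using aspect_ratio_weights[OF G _ aspect pL] r by blast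
    \<comment> \<open>Tours run through hop balls of radius at most \<open>L * h\<close>, so two of
      their vertices are joined through the centre within twice as many hops.\<close>
    define q where "q = 2 * (L * h)"
    obtain T where T: "realisable G w (J * q) T" "depth T \<le> Suc L" "set (labels T) = verts G"
      "real (length (labels T)) \<le> real (card (verts G)) powr (1 + 1 / real k)"
      "count_list (labels T) r = 1"
      and cover: "\<And>\<sigma>. \<sigma> \<noteq> [] \<Longrightarrow> set \<sigma> \<subseteq> verts G \<Longrightarrow> short_detours G w q \<sigma> \<Longrightarrow>
        len w \<sigma> < 2 ^ L * \<rho> \<Longrightarrow> cover T (set \<sigma>) (8 * real J * real L * len w \<sigma>)"
      using link_tree_exists[where w = w and q = q and L = L, OF fin k pm \<rho>(1,2) J_def r] by blast
    let ?T = "tree_graph T 0" and ?w = "tree_weight T 0"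
    obtain P where P: "path_tree_embedding G w ?T ?w (copies T) P"
      "has_hop_bound G ?T ?w (copies T) P (real (2 * depth T * (J * q)))"
      using link_tree_embedding[OF G T(1,3)] by blast
    have union: "(\<Union>v\<in>verts G. copies T v) = verts ?T"
      using P(1) by (simp add: path_tree_embedding_def)
    show "\<exists>(T :: nat ugraph) wT f P. path_tree_embedding G w T wT f P \<and>
        has_hop_bound G T wT f P (24 * a\<^sup>2 * real k * ?l^2 * ?ll * real h) \<and>
        real (card (\<Union>v\<in>verts G. f v)) \<le> (2 * real n) powr (1 + 1 / real k) \<and>
        card (f r) = 1 \<and>
        (\<forall>H. subgraph H G \<longrightarrow>
          (\<exists>H'. subgraph H' T \<and>
            (\<forall>u\<in>verts H. \<forall>v\<in>verts H. hop_dist H u v \<le> enat h \<longrightarrow>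
              (\<exists>u'\<in>f u \<inter> verts H'. \<exists>v'\<in>f v \<inter> verts H'. same_component H' u' v')) \<and>
            graph_weight wT H' \<le> ennreal (192 * a * real k * ?l * ?ll) * graph_weight w H))"
    proof (rule exI[of _ ?T], intro exI[of _ ?w] exI[of _ "copies T"] exI[of _ P] conjI allI impI)
      show "path_tree_embedding G w ?T ?w (copies T) P" by (rule P(1))
      have "real (2 * depth T * (J * q)) \<le> 24 * a\<^sup>2 * real k * ?l^2 * ?ll * real h"
      proof -
        have "real (2 * depth T * (J * q)) = 4 * (real (depth T) * real L) * real J * real h"
          by (simp add: q_def)
        also have "\<dots> \<le> 4 * ((a * ?l) * (a * ?l)) * (6 * (real k * ?ll)) * real h"
          using T(2) La J6 lg a by (intro mult_mono mult_nonneg_nonneg) auto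
        also have "\<dots> = 24 * a\<^sup>2 * real k * ?l^2 * ?ll * real h" by (simp add: power2_eq_square)
        finally show ?thesis .
      qed
      then show "has_hop_bound G ?T ?w (copies T) P (24 * a\<^sup>2 * real k * ?l^2 * ?ll * real h)"
        using P(2) unfolding has_hop_bound_def by (meson order_trans)
      have "real (length (labels T)) \<le> (2 * real n) powr (1 + 1 / real k)"
        using T(4) powr_mono2[of "1 + 1 / real k" "real n" "2 * real n"] by (simp add: n)
      then show "real (card (\<Union>v\<in>verts G. copies T v)) \<le> (2 * real n) powr (1 + 1 / real k)"
        by (simp add: union)
      have "copies T r = {i. i < length (labels T) \<and> r = labels T ! i}"
        by (auto simp: copies_def node_label_def)
      then show "card (copies T r) = 1"
        using T(5) by (simp add: count_list_eq_length_filter length_filter_conv_card)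
      fix H assume H: "subgraph H G"
      then have HG: "edges H \<subseteq> edges G" "verts H \<subseteq> verts G" by (auto simp: subgraph_def)
      note finE = card_edges_le(1)[OF gr]
      have "wsum w (edges G) < 2 ^ L * \<rho>" using \<rho>(3) wsum_nonneg[of w "edges G"] by linarith
      then obtain \<Sigma> where \<Sigma>: "\<And>\<sigma>. \<sigma> \<in> set \<Sigma> \<Longrightarrow> \<sigma> \<noteq> [] \<and> set \<sigma> \<subseteq> verts G \<and>
          short_detours G w q \<sigma> \<and> len w \<sigma> \<le> 2 * wsum w (edges H)"
        and len: "(\<Sum>\<sigma>\<leftarrow>\<Sigma>. len w \<sigma>) \<le> 4 * wsum w (edges H)"
        and tours: "\<And>p. walk \<lparr>verts = verts G, edges = edges H\<rparr> p \<Longrightarrow> 0 < hop p \<Longrightarrow> hop p \<le> h \<Longrightarrow>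
          \<exists>\<sigma>\<in>set \<Sigma>. hd p \<in> set \<sigma> \<and> last p \<in> set \<sigma>"
        using covering_tours[where w = w and L = L and h = h, OF gr \<rho>(1,2) _ finE HG(1)] unfolding q_def by blast
      let ?c = "8 * real J * real L"
      have "cover T (set \<sigma>) (?c * len w \<sigma>) \<and> 0 \<le> ?c * len w \<sigma>" if "\<sigma> \<in> set \<Sigma>" for \<sigma>
      proof -
        have "len w \<sigma> < 2 ^ L * \<rho>" using \<Sigma>[OF that] wsum_mono[OF finE HG(1), of w] \<rho>(3) by linarith
        then show ?thesis using cover \<Sigma>[OF that] by simp
      qed
      then obtain H' where H': "subgraph H' ?T" "verts H' = verts ?T"
        "\<And>\<sigma> u v. \<sigma> \<in> set \<Sigma> \<Longrightarrow> u \<in> set \<sigma> \<Longrightarrow> v \<in> set \<sigma> \<Longrightarrow> \<exists>u'\<in>verts H'. \<exists>v'\<in>verts H'.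
          node_label T 0 u' = u \<and> node_label T 0 v' = v \<and> same_component H' u' v'"
        "graph_weight ?w H' \<le> ennreal (\<Sum>\<sigma>\<leftarrow>\<Sigma>. ?c * len w \<sigma>)"
        using covers_subgraph[of \<Sigma> T "\<lambda>\<sigma>. ?c * len w \<sigma>" 0] by blast
      show "\<exists>H'. subgraph H' ?T \<and>
          (\<forall>u\<in>verts H. \<forall>v\<in>verts H. hop_dist H u v \<le> enat h \<longrightarrow>
            (\<exists>u'\<in>copies T u \<inter> verts H'. \<exists>v'\<in>copies T v \<inter> verts H'. same_component H' u' v')) \<and>
          graph_weight ?w H' \<le> ennreal (192 * a * real k * ?l * ?ll) * graph_weight w H"
      proof (intro exI[of _ H'] conjI ballI impI)
        show "subgraph H' ?T" by (rule H'(1))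
        fix u v assume uv: "u \<in> verts H" "v \<in> verts H" "hop_dist H u v \<le> enat h"
        obtain p where p: "walk H p" "hd p = u" "last p = v" "hop p \<le> h"
          using hop_dist_le_imp_path[OF uv(3)] by (auto simp: path_def)
        show "\<exists>u'\<in>copies T u \<inter> verts H'. \<exists>v'\<in>copies T v \<inter> verts H'. same_component H' u' v'"
        proof (cases "hop p = 0")
          \<comment> \<open>Tours are only promised for walks with at least one edge; the case
            \<open>u = v\<close> is settled by a single node.\<close>
          case True
          then have "u = v" using p walk_nonempty[OF p(1)] by (cases p rule: walk_edges.cases) auto
          moreover have "one_to_many G ?T (copies T)" using P(1) by (simp add: path_tree_embedding_def)
          then obtain x where "x \<in> copies T u" using uv(1) HG(2) unfolding one_to_many_def by blast
          moreover from this have "x \<in> verts H'" using H'(2) by (simp add: copies_def)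
          ultimately show ?thesis using same_component_refl[of x H'] by blast
        next
          case False
          have "walk \<lparr>verts = verts G, edges = edges H\<rparr> p" using p(1) by (rule walk_mono) (use HG in auto)
          then obtain \<sigma> where \<sigma>: "\<sigma> \<in> set \<Sigma>" "u \<in> set \<sigma>" "v \<in> set \<sigma>" using tours False p by blast
          then obtain u' v' where "u' \<in> verts H'" "v' \<in> verts H'" "node_label T 0 u' = u"
            "node_label T 0 v' = v" "same_component H' u' v'" using H'(3) by blast
          moreover from this have "u' \<in> copies T u" "v' \<in> copies T v" by (simp_all add: copies_def H'(2))
          ultimately show ?thesis by blast
        qed
      next
        have "(\<Sum>\<sigma>\<leftarrow>\<Sigma>. ?c * len w \<sigma>) = ?c * (\<Sum>\<sigma>\<leftarrow>\<Sigma>. len w \<sigma>)" by (rule sum_list_const_mult)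
        also have "\<dots> \<le> ?c * (4 * wsum w (edges H))" using len by (intro mult_left_mono) auto
        also have "\<dots> = 32 * (real J * real L) * wsum w (edges H)" by simp
        also have "\<dots> \<le> 32 * (6 * (real k * ?ll) * (a * ?l)) * wsum w (edges H)"
          using J6 La by (intro mult_right_mono mult_left_mono mult_mono) auto
        finally have "(\<Sum>\<sigma>\<leftarrow>\<Sigma>. ?c * len w \<sigma>) \<le> 192 * a * real k * ?l * ?ll * wsum w (edges H)"
          by (simp add: mult_ac)
        then have "graph_weight ?w H' \<le> ennreal (192 * a * real k * ?l * ?ll * wsum w (edges H))"
          using H'(4) ennreal_leI order_trans by blast
        also have "\<dots> = ennreal (192 * a * real k * ?l * ?ll) * graph_weight w H"
          using a lg by (simp add: graph_weight_eq_wsum[OF G HG(1)] ennreal_mult)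
        finally show "graph_weight ?w H' \<le> ennreal (192 * a * real k * ?l * ?ll) * graph_weight w H" .
      qed
    qed
  qed
qed

end
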